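(* For complex $u$, let $$ \mathcal{L}(u) := \operatorname{Li}_{2}\left( \frac{ 2-\sqrt{4 - 3 u} \sqrt{u}-u }{2} \right) + \operatorname{Li}_{2}\left( \frac{2+\sqrt{4-3 u} \sqrt{u}-u}{2} \right) + \operatorname{Li}_{2}(u) $$ and \begin{multline*} \mathcal{E}(u) := \frac{1}{3} \ln^2\left(\frac{2}{\sqrt{4-3 u} \sqrt{u}-u} + 1\right) -\frac{1}{2} \ln ^2\left(-\frac{2}{-u+\sqrt{4-3 u} \sqrt{u}+2}\right) - \frac{1}{2} \ln ^2\left(\frac{2}{u+\sqrt{4-3 u} \sqrt{u}-2}\right)\\ +\frac{1}{3} \ln^2\left(1-\frac{2}{u+\sqrt{4-3 u} \sqrt{u}}\right) - \frac{2}{3} \ln (1-u) \ln (-u) + \frac{1}{3} \ln ^2(1-u) - \frac{1}{6} \ln ^2(-u) -\frac{\pi ^2}{2}. \end{multline*} Then $\mathcal{L}(u) = \mathcal{E}(u)$ for all $u \in \mathbb{C} \setminus \mathbb{R}_{>0}$. For $u \in \mathbb{R}_{>0}$, $\Re\,\mathcal{L}(u) = \Re\,\mathcal{E}(u)$ and $$ \lim_{b \to 0} \Im\,\mathcal{L}(u + bi) = \lim_{b \to 0} \Im\,\mathcal{E}(u + bi). $$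
   Context: $\operatorname{Li}_2(x)=\sum_{n\ge1}x^n/n^2$ for $|x|\le1$, extended by analytic continuation (principal branch, cut along $[1,\infty)$); $\ln$ and $\sqrt{\cdot}$ denote principal branches; $b$ is real.
   Formalization: E(u) is undefined at u=0 and u=1, so there the identity is stated as a limit; the limit b→0, which in general does not exist two-sidedly, is stated as equality of both one-sided limits; on its cut x>1, Li_2 takes the boundary value from above. *)

theory Defs
  imports "HOL-Complex_Analysis.Complex_Analysis"
begin

definition dilog_series :: "complex \<Rightarrow> complex" where
  "dilog_series z = (\<Sum>n. z ^ Suc n / of_nat (Suc n) ^ 2)"

definition dilog_cut :: "complex set" where
  "dilog_cut = complex_of_real ` {1..}"

(* The value is determined only off the cut, where it is unique by the identity theorem. *)
definition dilog_slit :: "complex \<Rightarrow> complex" where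
  "dilog_slit = (SOME f. f holomorphic_on - dilog_cut \<and> (\<forall>z\<in>ball 0 1. f z = dilog_series z))"

(* The principal branch.  On the open cut {x. x > 1} it takes the boundary value from the upper
   half-plane, Im (dilog x) = pi * ln x; many systems use the conjugate value.  The choice matters:
   for example csqrt (4 - 3 * \<i>) * csqrt \<i> = 2 + \<i>, so the second dilogarithm in L_dilog \<i>
   is dilog 2.  The first case also covers z = 1. *)
definition dilog :: "complex \<Rightarrow> complex" where
  "dilog z =
     (if norm z \<le> 1 then dilog_series z
      else if z \<notin> dilog_cut then dilog_slit z
      else Lim (at_right (0::real)) (\<lambda>t. dilog_slit (z + of_real t * \<i>)))"

definition L_dilog :: "complex \<Rightarrow> complex" where
  "L_dilog u =
     dilog ((2 - csqrt (4 - 3 * u) * csqrt u - u) / 2)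
   + dilog ((2 + csqrt (4 - 3 * u) * csqrt u - u) / 2)
   + dilog u"

(* The denominators and the arguments of ln below all are nonzero unless u = 0 or u = 1; at those
   two points the totalised value of the formula is meaningless. *)
definition E_log :: "complex \<Rightarrow> complex" where
  "E_log u =
     1/3 * (ln (2 / (csqrt (4 - 3 * u) * csqrt u - u) + 1))\<^sup>2
   - 1/2 * (ln (- (2 / (- u + csqrt (4 - 3 * u) * csqrt u + 2))))\<^sup>2
   - 1/2 * (ln (2 / (u + csqrt (4 - 3 * u) * csqrt u - 2)))\<^sup>2
   + 1/3 * (ln (1 - 2 / (u + csqrt (4 - 3 * u) * csqrt u)))\<^sup>2
   - 2/3 * ln (1 - u) * ln (- u)
   + 1/3 * (ln (1 - u))\<^sup>2
   - 1/6 * (ln (- u))\<^sup>2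
   - (of_real pi)\<^sup>2 / 2"

definition pos_reals :: "complex set" where
  "pos_reals = complex_of_real ` {0<..}"

end

theory Submission
  imports Defs "HOL-Real_Asymp.Real_Asymp"
begin

text \<open>Write \<open>x\<close>, \<open>y\<close> for the arguments of the first two dilogarithms; they are characterised by
  \<open>x + y = 2 - u\<close> and \<open>x y = (1 - u)\<^sup>2\<close>.  The inversion formula turns \<open>Li(x) + Li(y)\<close> into
  \<open>- Li(1/x) - Li(1/y)\<close> and removes exactly the two terms of \<open>E_log\<close> with coefficient \<open>-1/2\<close>.
  These terms carry the whole discontinuity of \<open>L_dilog\<close> off \<open>u > 0\<close> (\<open>x\<close> or \<open>y\<close> crosses
  the cut along a hyperbola in the \<open>u\<close>-plane).  What remains is an identity between functions
  holomorphic off \<open>u \<ge> 0\<close>; both sides have the same derivative, and the constant is found by letting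
  \<open>u\<close> tend to \<open>0\<close> along the negative axis.  For \<open>u > 0\<close> one uses that the real parts of
  \<open>Li\<close> and of \<open>ln\<^sup>2\<close> are continuous across the cuts, and that \<open>x\<close>, \<open>y\<close> are non-real for
  \<open>u + b \<i>\<close> with small \<open>b \<noteq> 0\<close>, so that one-sided limits exist.\<close>

section \<open>The dilogarithm off its cut\<close>

lemma in_dilog_cut_iff: "z \<in> dilog_cut \<longleftrightarrow> Im z = 0 \<and> Re z \<ge> 1"
  by (force simp: dilog_cut_def complex_eq_iff image_iff)

lemma open_compl_dilog_cut: "open (- dilog_cut)"
proof -
  have "dilog_cut = {z. Im z = 0} \<inter> {z. Re z \<ge> 1}"
    by (auto simp: in_dilog_cut_iff)
  moreover have "closed ..."
    by (intro closed_Int closed_Collect_eq closed_Collect_le continuous_intros)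
  ultimately show ?thesis by (simp add: open_Compl)
qed

lemma starlike_compl_dilog_cut: "starlike (- dilog_cut)"
  unfolding dilog_cut_def by (rule starlike_slotted_complex_plane_right)

lemma one_minus_nonpos_Reals_iff: "1 - z \<in> \<real>\<^sub>\<le>\<^sub>0 \<longleftrightarrow> z \<in> dilog_cut"
  by (auto simp: in_dilog_cut_iff complex_nonpos_Reals_iff)

lemma ball_subset_compl_dilog_cut: "ball 0 1 \<subseteq> - dilog_cut"
proof
  fix z :: complex assume "z \<in> ball 0 1"
  then have "Re z < 1" using complex_Re_le_cmod[of z] by simp
  then show "z \<in> - dilog_cut" by (simp add: in_dilog_cut_iff)
qed

lemma cball_minus_one_subset_compl_dilog_cut: "cball 0 1 - {1} \<subseteq> - dilog_cut"
proof
  fix z :: complex assume z: "z \<in> cball 0 1 - {1}"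
  show "z \<in> - dilog_cut"
  proof
    assume "z \<in> dilog_cut"
    then have "Im z = 0" "Re z \<ge> 1" by (auto simp: in_dilog_cut_iff)
    moreover from this z have "Re z \<le> 1" using complex_Re_le_cmod[of z] by simp
    ultimately show False using z by (auto simp: complex_eq_iff)
  qed
qed

section \<open>The power series on the closed unit disc\<close>

lemma dilog_series_sums:
  assumes "norm z \<le> 1"
  shows "(\<lambda>n. z ^ Suc n / of_nat (Suc n) ^ 2) sums dilog_series z"
proof -
  have "summable (\<lambda>n. z ^ Suc n / of_nat (Suc n) ^ 2)"
  proof (rule summable_comparison_test')
    show "summable (\<lambda>n. 1 / (real n + 1)\<^sup>2)"
      using inverse_squares_sums sums_summable by (simp add: add.commute)
    fix n
    have "norm z ^ Suc n \<le> 1" using assms by (simp add: power_le_one del: power_Suc)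
    then show "norm (z ^ Suc n / of_nat (Suc n) ^ 2) \<le> 1 / (real n + 1)\<^sup>2"
      by (simp add: norm_divide norm_power norm_mult divide_right_mono add.commute flip: of_nat_Suc)
  qed
  then show ?thesis unfolding dilog_series_def by (rule summable_sums)
qed

lemma dilog_series_0: "dilog_series 0 = 0"
  by (simp add: dilog_series_def)

lemma dilog_series_1: "dilog_series 1 = (of_real pi)\<^sup>2 / 6"
proof -
  have "(\<lambda>n. complex_of_real (1 / real ((n + 1)\<^sup>2))) sums of_real (pi\<^sup>2 / 6)"
    using inverse_squares_sums by (simp only: sums_of_real_iff)
  then have "(\<lambda>n. 1 ^ Suc n / of_nat (Suc n) ^ 2) sums ((complex_of_real pi)\<^sup>2 / 6)"
    by (simp add: add.commute)
  then show ?thesis using dilog_series_sums[of 1] sums_unique2 by fastforce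
qed

text \<open>Continuity reaches the boundary, in particular the point 1; the limits involving pi^2/6
  below rest on this.\<close>

lemma continuous_on_dilog_series: "continuous_on (cball 0 1) dilog_series"
proof -
  have "uniform_limit (cball 0 1) (\<lambda>n z. \<Sum>i<n. z ^ Suc i / complex_of_nat (Suc i) ^ 2)
          dilog_series sequentially"
    unfolding dilog_series_def
  proof (rule Weierstrass_m_test)
    show "summable (\<lambda>n. 1 / (real n + 1)\<^sup>2)"
      using inverse_squares_sums sums_summable by (simp add: add.commute)
    fix n and z :: complex assume "z \<in> cball 0 1"
    then have "norm z ^ Suc n \<le> 1" by (simp add: power_le_one del: power_Suc)
    then show "norm (z ^ Suc n / of_nat (Suc n) ^ 2) \<le> 1 / (real n + 1)\<^sup>2"
      by (simp add: norm_divide norm_power norm_mult divide_right_mono add.commute flip: of_nat_Suc)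
  qed
  then show ?thesis
    by (rule uniform_limit_theorem[rotated]) (auto intro!: always_eventually continuous_intros simp del: of_nat_Suc)
qed

text \<open>Termwise differentiation. The value at 0 is listed apart because the quotient totalises
  to 0 there, while the derivative is 1.\<close>

lemma has_field_derivative_dilog_series:
  assumes z: "norm z < 1"
  shows "(dilog_series has_field_derivative (if z = 0 then 1 else - ln (1 - z) / z)) (at z)"
proof -
  \<comment> \<open>Indexing from 0 gives a power series in standard form; \<open>c 0\<close> is 0
    by the convention for division by zero, so the shift adds no term.\<close>
  define c :: "nat \<Rightarrow> complex" where "c n = 1 / of_nat n ^ 2" for n
  have eq: "(\<Sum>n. c n * w ^ n) = dilog_series w" if "norm w \<le> 1" for w
  proof -
    have "(\<lambda>n. c (Suc n) * w ^ Suc n) sums dilog_series w"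
      using dilog_series_sums[OF that] by (simp add: c_def)
    then have "(\<lambda>n. c n * w ^ n) sums (dilog_series w + c 0 * w ^ 0)"
      by (subst (asm) sums_Suc_iff) (simp add: c_def)
    then show ?thesis by (simp add: c_def sums_iff)
  qed
  have "summable (\<lambda>n. c n * 1 ^ n)"
    using dilog_series_sums[of 1] by (subst summable_Suc_iff[symmetric]) (simp add: c_def sums_iff)
  from termdiffs_strong[OF this, of z] z
  have D: "((\<lambda>w. \<Sum>n. c n * w ^ n) has_field_derivative (\<Sum>n. diffs c n * z ^ n)) (at z)"
    by simp
  have "summable (\<lambda>n. c n * w ^ n)" if "norm w < 1" for w
    using dilog_series_sums[of w] that
    by (subst summable_Suc_iff[symmetric]) (simp add: c_def sums_iff)
  then have sm: "summable (\<lambda>n. diffs c n * z ^ n)"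
    by (intro termdiff_converges[OF z]) 
  have sum_eq: "(\<Sum>n. diffs c n * z ^ n) = (if z = 0 then 1 else - ln (1 - z) / z)"
  proof (cases "z = 0")
    case True
    then show ?thesis using powser_zero[of "diffs c"] by (simp add: diffs_def c_def)
  next
    case False
    have "(\<lambda>n. - (z ^ Suc n) / of_nat (Suc n)) sums ln (1 - z)"
      using Ln_series'[of "- z"] z by (subst sums_Suc_iff) simp
    moreover have "(\<lambda>n. - z * (diffs c n * z ^ n)) sums (- z * (\<Sum>n. diffs c n * z ^ n))"
      by (intro sums_mult summable_sums sm)
    moreover have "- z * (diffs c n * z ^ n) = - (z ^ Suc n) / of_nat (Suc n)" for n
    proof -
      have "of_nat (Suc n) \<noteq> (0::complex)" by (rule of_nat_neq_0)
      then show ?thesis unfolding diffs_def c_def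
        by (simp add: field_simps power2_eq_square del: of_nat_Suc)
    qed
    ultimately have "- z * (\<Sum>n. diffs c n * z ^ n) = ln (1 - z)"
      by (simp only: sums_unique2)
    then have "(\<Sum>n. diffs c n * z ^ n) * z = - ln (1 - z)"
      by (metis minus_minus minus_mult_left mult.commute)
    with False show ?thesis by (simp only: nonzero_eq_divide_eq if_False simp_thms)
  qed
  show ?thesis
    by (rule has_field_derivative_transform_within_open[OF D[unfolded sum_eq], of "ball 0 1"])
       (use z eq in auto)
qed

section \<open>Analytic continuation to the slit plane\<close>

text \<open>The expected derivative \<open>- ln (1 - z) / z\<close>, completed by 1 at 0, is
  continuous on a starlike domain and differentiable off 0, so it has a primitive. On the disc the
  primitive differs from the series by a constant. Thus the choice in \<open>dilog_slit\<close> is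
  meaningful.\<close>

lemma dilog_slit_exists:
  "\<exists>f. f holomorphic_on - dilog_cut \<and> (\<forall>z\<in>ball 0 1. f z = dilog_series z)"
proof -
  define g :: "complex \<Rightarrow> complex" where "g z = (if z = 0 then 1 else - ln (1 - z) / z)" for z
  have diff: "g field_differentiable at z" if "z \<in> - dilog_cut - {0}" for z
  proof -
    have "(\<lambda>z. - ln (1 - z) / z) holomorphic_on - dilog_cut - {0}"
      by (intro holomorphic_intros) (auto simp: one_minus_nonpos_Reals_iff)
    then have "g holomorphic_on - dilog_cut - {0}"
      by (rule holomorphic_transform) (auto simp: g_def)
    then show ?thesis
      using that open_compl_dilog_cut
      by (intro holomorphic_on_imp_differentiable_at[of _ "- dilog_cut - {0}"] open_delete) auto
  qed
  \<comment> \<open>Away from 0, \<open>g\<close> is minus the difference quotient of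
    \<open>ln (1 - z)\<close> at 0.\<close>
  have "g \<midarrow>0\<rightarrow> g 0"
  proof -
    have "((\<lambda>z. ln (1 - z)) has_field_derivative - 1) (at (0::complex))"
      by (auto intro!: derivative_eq_intros)
    then have "(\<lambda>z. (ln (1 - z) - ln (1 - 0)) / (z - 0)) \<midarrow>0\<rightarrow> (- 1::complex)"
      by (simp only: has_field_derivative_iff)
    from tendsto_minus[OF this] have "(\<lambda>z. - ln (1 - z) / z) \<midarrow>0\<rightarrow> (1::complex)"
      by simp
    then show ?thesis
      by (subst g_def, simp, elim Lim_transform_eventually) (auto simp: g_def eventually_at_filter)
  qed
  then have "isCont g z" if "z \<in> - dilog_cut" for z
    using that field_differentiable_imp_continuous_at[OF diff, of z]
    by (cases "z = 0") (simp_all add: isCont_def)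
  then have "continuous_on (- dilog_cut) g"
    by (simp add: continuous_at_imp_continuous_on)
  from holomorphic_starlike_primitive[OF this starlike_compl_dilog_cut open_compl_dilog_cut, of "{0}"]
  obtain h where h: "(h has_field_derivative g z) (at z)" if "z \<in> - dilog_cut" for z
    using diff by auto
  have "((\<lambda>z. h z - dilog_series z) has_field_derivative 0) (at z)" if "z \<in> ball 0 1" for z
  proof -
    have "(h has_field_derivative g z) (at z)"
      using that ball_subset_compl_dilog_cut by (intro h) blast
    from DERIV_diff[OF this has_field_derivative_dilog_series[of z]] that show ?thesis
      by (simp add: g_def)
  qed
  then obtain k where k: "\<And>z. z \<in> ball 0 1 \<Longrightarrow> h z - dilog_series z = k"
    using has_field_derivative_zero_constant[of "ball 0 1" "\<lambda>z. h z - dilog_series z"]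
    by (metis DERIV_subset convex_ball subset_UNIV)
  show ?thesis
  proof (intro exI conjI ballI)
    show "(\<lambda>z. h z - k) holomorphic_on - dilog_cut"
      using h by (intro holomorphic_intros)
        (auto simp: holomorphic_on_def field_differentiable_def intro: has_field_derivative_at_within)
    show "h z - k = dilog_series z" if "z \<in> ball 0 1" for z
      using k[OF that] by (simp add: algebra_simps)
  qed
qed

lemma holomorphic_dilog_slit: "dilog_slit holomorphic_on - dilog_cut"
  and dilog_slit_eq_series: "z \<in> ball 0 1 \<Longrightarrow> dilog_slit z = dilog_series z"
  using someI_ex[OF dilog_slit_exists] unfolding dilog_slit_def[symmetric] by blast+

text \<open>The formula holds in the disc and spreads by the identity theorem. It is first
  multiplied by z, so that no quotient at 0 disturbs holomorphy.\<close>

lemma has_field_derivative_dilog_slit: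
  assumes z: "z \<notin> dilog_cut"
  shows "(dilog_slit has_field_derivative (if z = 0 then 1 else - ln (1 - z) / z)) (at z)"
proof -
  have deriv_in_ball: "deriv dilog_slit w = (if w = 0 then 1 else - ln (1 - w) / w)"
    if "w \<in> ball 0 1" for w
    by (rule DERIV_imp_deriv, rule has_field_derivative_transform_within_open
          [OF has_field_derivative_dilog_series, of _ "ball 0 1"])
       (use that dilog_slit_eq_series in auto)
  have "z * deriv dilog_slit z + ln (1 - z) = 0"
  proof (rule analytic_continuation_open[of "ball 0 1" "- dilog_cut"
        "\<lambda>z. z * deriv dilog_slit z + ln (1 - z)" "\<lambda>_. 0"])
    show "connected (- dilog_cut)"
      by (simp add: starlike_compl_dilog_cut starlike_imp_connected)
    show "(\<lambda>z. z * deriv dilog_slit z + ln (1 - z)) holomorphic_on - dilog_cut"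
      by (intro holomorphic_intros holomorphic_deriv holomorphic_dilog_slit open_compl_dilog_cut)
         (auto simp: one_minus_nonpos_Reals_iff)
    show "w * deriv dilog_slit w + ln (1 - w) = 0" if "w \<in> ball 0 1" for w
      by (simp add: deriv_in_ball[OF that])
  qed (use z ball_subset_compl_dilog_cut open_compl_dilog_cut in auto)
  then have "deriv dilog_slit z = (if z = 0 then 1 else - ln (1 - z) / z)"
    using deriv_in_ball[of 0] by (auto simp: field_simps add_eq_0_iff)
  moreover have "(dilog_slit has_field_derivative deriv dilog_slit z) (at z)"
    using z open_compl_dilog_cut holomorphic_dilog_slit
    by (intro holomorphic_derivI) auto
  ultimately show ?thesis by simp
qed

lemma has_field_derivative_dilog_slit_compose [derivative_intros]:
  assumes "(f has_field_derivative f') (at z within S)" "f z \<notin> dilog_cut" "f z \<noteq> 0"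
  shows "((\<lambda>z. dilog_slit (f z)) has_field_derivative - ln (1 - f z) / f z * f') (at z within S)"
  using DERIV_chain2[OF has_field_derivative_dilog_slit assms(1)] assms(2,3) by simp

lemma isCont_dilog_slit: "z \<notin> dilog_cut \<Longrightarrow> isCont dilog_slit z"
  using has_field_derivative_dilog_slit DERIV_isCont by blast

text \<open>Radial approach: at \<open>t * z\<close> with 0 < t < 1 the two functions agree, and
  both converge as t tends to 1.\<close>

lemma dilog_series_eq_slit:
  assumes "norm z \<le> 1" "z \<noteq> 1"
  shows "dilog_series z = dilog_slit z"
proof (rule tendsto_unique)
  let ?F = "at_left (1::real)"
  have lim: "((\<lambda>t. of_real t * z) \<longlongrightarrow> z) ?F"
    by (auto intro!: tendsto_eq_intros)
  have ball: "of_real t * z \<in> ball 0 1" if "t \<in> {0<..<1}" for t :: real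
  proof -
    have "t * norm z \<le> t * 1" using that assms by (intro mult_left_mono) auto
    also have "t * 1 < 1" using that by simp
    finally show ?thesis using that by (simp add: norm_mult)
  qed
  have ev: "eventually (\<lambda>t. t \<in> {0<..<1}) ?F"
    by (rule eventually_at_leftI[of 0]) auto
  show "((\<lambda>t. dilog_series (of_real t * z)) \<longlongrightarrow> dilog_series z) ?F"
    by (rule continuous_on_tendsto_compose[OF continuous_on_dilog_series lim])
       (use assms ball in \<open>auto intro!: eventually_mono[OF ev] less_imp_le\<close>)
  have "z \<notin> dilog_cut"
    using assms cball_minus_one_subset_compl_dilog_cut by auto
  then have "((\<lambda>t. dilog_slit (of_real t * z)) \<longlongrightarrow> dilog_slit z) ?F"
    by (intro isCont_tendsto_compose[OF isCont_dilog_slit] lim)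
  then show "((\<lambda>t. dilog_series (of_real t * z)) \<longlongrightarrow> dilog_slit z) ?F"
    by (rule Lim_transform_eventually)
       (use ball dilog_slit_eq_series in \<open>auto intro!: eventually_mono[OF ev]\<close>)
qed simp

lemma norm_gt_1_if_in_dilog_cut:
  assumes "z \<in> dilog_cut" "z \<noteq> 1"
  shows "norm z > 1"
  using assms cball_minus_one_subset_compl_dilog_cut by (meson ComplD Diff_iff mem_cball_0 not_le singletonD subsetD)

lemma dilog_eq_slit: "z \<notin> dilog_cut \<Longrightarrow> dilog z = dilog_slit z"
  using dilog_series_eq_slit[of z] by (cases "z = 1") (auto simp: dilog_def in_dilog_cut_iff)

lemma dilog_0: "dilog 0 = 0"
  by (simp add: dilog_def dilog_series_0)

lemma dilog_1: "dilog 1 = (of_real pi)\<^sup>2 / 6"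
  by (simp add: dilog_def dilog_series_1)

section \<open>Inversion and boundary behaviour\<close>

text \<open>Multiplication by \<open>- \<i>\<close> moves the closed upper half-plane without 0 into
  the region where \<open>ln\<close> is continuous; the principal value on the negative axis is the
  limit from above.\<close>

lemma tendsto_ln_upper:
  fixes f :: "'a \<Rightarrow> complex"
  assumes f: "(f \<longlongrightarrow> z) F" and z: "z \<noteq> 0" and Im: "\<forall>\<^sub>F b in F. Im (f b) \<ge> 0"
  shows "((\<lambda>b. ln (f b)) \<longlongrightarrow> ln z) F"
proof (cases "F = bot")
  case False
  have Imz: "Im z \<ge> 0"
    by (rule tendsto_lowerbound[OF tendsto_Im[OF f] Im False])
  have *: "ln w = ln (- \<i> * w) + \<i> * of_real pi / 2" if "w \<noteq> 0" "Im w \<ge> 0" for w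
    using Ln_times_ii[of "- \<i> * w"] that by (auto simp: mult.assoc[symmetric])
  have "- \<i> * z \<notin> \<real>\<^sub>\<le>\<^sub>0"
    using z Imz by (auto simp: complex_nonpos_Reals_iff complex_eq_iff)
  then have "((\<lambda>b. ln (- \<i> * f b) + \<i> * of_real pi / 2) \<longlongrightarrow> ln (- \<i> * z) + \<i> * of_real pi / 2) F"
    by (intro tendsto_intros f)
  then show ?thesis
    unfolding *[OF z Imz, symmetric]
    by (rule Lim_transform_eventually)
       (use Im tendsto_imp_eventually_ne[OF f z] in eventually_elim, simp add: *)
qed simp

text \<open>Conjugation reduces this to the upper half-plane. The limit differs from
  \<open>ln z\<close> only for negative real z, where it is the value with argument -pi.\<close>

lemma tendsto_ln_lower:
  fixes f :: "'a \<Rightarrow> complex"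
  assumes f: "(f \<longlongrightarrow> z) F" and z: "z \<noteq> 0" and Im: "\<forall>\<^sub>F b in F. Im (f b) < 0"
  shows "((\<lambda>b. ln (f b)) \<longlongrightarrow> cnj (ln (cnj z))) F"
proof -
  have "((\<lambda>b. cnj (ln (cnj (f b)))) \<longlongrightarrow> cnj (ln (cnj z))) F"
    using Im by (intro tendsto_intros tendsto_ln_upper f) 
      (auto simp: z elim: eventually_mono)
  then show ?thesis
  proof (rule Lim_transform_eventually)
    show "\<forall>\<^sub>F b in F. cnj (ln (cnj (f b))) = ln (f b)"
      using Im by eventually_elim (subst cnj_Ln, auto simp: complex_nonpos_Reals_iff)
  qed
qed

text \<open>The origin is the only point of the cut where the square root is continuous: its modulus
  there tends to 0.\<close>

lemma isCont_csqrt_0: "isCont csqrt 0"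
proof -
  have "isCont (\<lambda>z. sqrt (norm z)) (0::complex)"
    by (intro continuous_intros)
  then have "(\<lambda>z. norm (csqrt z)) \<midarrow>0\<rightarrow> 0" by (simp add: isCont_def)
  then show ?thesis unfolding isCont_def csqrt_0 by (rule tendsto_norm_zero_cancel)
qed

lemma tendsto_csqrt_upper:
  assumes f: "(f \<longlongrightarrow> z) F" and Im: "\<forall>\<^sub>F b in F. Im (f b) \<ge> 0"
  shows "((\<lambda>b. csqrt (f b)) \<longlongrightarrow> csqrt z) F"
proof (cases "z = 0")
  case True
  then show ?thesis using isCont_tendsto_compose[OF isCont_csqrt_0] f by blast
next
  case False
  have "((\<lambda>b. exp (ln (f b) / 2)) \<longlongrightarrow> exp (ln z / 2)) F"
    by (intro tendsto_intros tendsto_ln_upper f False Im) simp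
  then show ?thesis
    unfolding csqrt_exp_Ln[OF False]
    by (rule Lim_transform_eventually)
       (use tendsto_imp_eventually_ne[OF f False] in eventually_elim, simp add: csqrt_exp_Ln)
qed

lemma tendsto_csqrt_lower:
  assumes f: "(f \<longlongrightarrow> z) F" and Im: "\<forall>\<^sub>F b in F. Im (f b) < 0"
  shows "((\<lambda>b. csqrt (f b)) \<longlongrightarrow> cnj (csqrt (cnj z))) F"
proof -
  have "((\<lambda>b. cnj (csqrt (cnj (f b)))) \<longlongrightarrow> cnj (csqrt (cnj z))) F"
    using Im by (intro tendsto_intros tendsto_csqrt_upper f) (auto elim: eventually_mono)
  then show ?thesis
  proof (rule Lim_transform_eventually)
    show "\<forall>\<^sub>F b in F. cnj (csqrt (cnj (f b))) = csqrt (f b)"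
      using Im by eventually_elim (subst cnj_csqrt, auto simp: complex_nonpos_Reals_iff)
  qed
qed

section \<open>The inversion formula\<close>

text \<open>Common scheme of the identities below: a vanishing derivative on a connected domain
  gives a constant, and a limit along any \<open>p\<close> inside the domain, possibly towards its
  boundary, evaluates it.\<close>

lemma constant_off_nonneg_Reals:
  fixes f :: "complex \<Rightarrow> complex" and p :: "'a \<Rightarrow> complex"
  assumes D: "\<And>z. z \<notin> \<real>\<^sub>\<ge>\<^sub>0 \<Longrightarrow> (f has_field_derivative 0) (at z)"
    and lim: "((\<lambda>t. f (p t)) \<longlongrightarrow> c) F" and p: "\<forall>\<^sub>F t in F. p t \<notin> \<real>\<^sub>\<ge>\<^sub>0" and F: "F \<noteq> bot"
    and z: "z \<notin> \<real>\<^sub>\<ge>\<^sub>0"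
  shows "f z = c"
proof -
  have "- \<real>\<^sub>\<ge>\<^sub>0 = - complex_of_real ` {0..}"
    by (auto simp: nonneg_Reals_def)
  then have "connected (- \<real>\<^sub>\<ge>\<^sub>0 :: complex set)"
    by (metis starlike_slotted_complex_plane_right starlike_imp_connected)
  moreover have "open (- \<real>\<^sub>\<ge>\<^sub>0 :: complex set)"
    by (simp add: open_Compl closed_nonneg_Reals_complex)
  moreover have "continuous_on (- \<real>\<^sub>\<ge>\<^sub>0) f"
    using D DERIV_isCont by (intro continuous_at_imp_continuous_on) blast
  ultimately obtain k where k: "f w = k" if "w \<notin> \<real>\<^sub>\<ge>\<^sub>0" for w
    using DERIV_zero_connected_constant[of "- \<real>\<^sub>\<ge>\<^sub>0" "{}" f] D by auto
  have "((\<lambda>t. f (p t)) \<longlongrightarrow> k) F"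
    by (rule tendsto_eventually) (use p k in \<open>auto elim: eventually_mono\<close>)
  with lim F have "c = k" by (metis tendsto_unique)
  with k z show ?thesis by simp
qed

lemma not_nonneg_Reals_imp:
  fixes z :: complex
  assumes "z \<notin> \<real>\<^sub>\<ge>\<^sub>0"
  shows "z \<noteq> 0" "z \<noteq> 1" "- z \<notin> \<real>\<^sub>\<le>\<^sub>0" "z \<notin> dilog_cut" "1 / z \<notin> \<real>\<^sub>\<ge>\<^sub>0" "1 - z \<notin> \<real>\<^sub>\<le>\<^sub>0"
  using assms by (auto simp: one_minus_nonpos_Reals_iff in_dilog_cut_iff complex_nonneg_Reals_iff
    complex_nonpos_Reals_iff Im_divide Re_divide zero_le_divide_iff mult_nonneg_nonneg)

lemma ln_one_minus_inverse:
  fixes z :: complex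
  assumes z: "z \<notin> \<real>\<^sub>\<ge>\<^sub>0"
  shows "ln (1 - 1 / z) = ln (1 - z) - ln (- z)"
proof -
  have "ln (1 - 1 / z) - ln (1 - z) + ln (- z) = 0"
  \<comment> \<open>At -1 the three logarithms are ln 2, ln 2 and ln 1, so the constant is
    0.\<close>
  proof (rule constant_off_nonneg_Reals[OF _ _ _ _ z, where p = "\<lambda>_::nat. - 1" and F = sequentially])
    fix w :: complex assume w: "w \<notin> \<real>\<^sub>\<ge>\<^sub>0"
    note w' = not_nonneg_Reals_imp[OF w] not_nonneg_Reals_imp[OF not_nonneg_Reals_imp(5)[OF w]]
    show "((\<lambda>z. ln (1 - 1 / z) - ln (1 - z) + ln (- z)) has_field_derivative 0) (at w)"
      using w' by (auto intro!: derivative_eq_intros simp: field_simps power2_eq_square)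
  qed (auto simp: complex_nonneg_Reals_iff)
  then show ?thesis by (simp add: algebra_simps)
qed

text \<open>The derivatives cancel by \<open>ln_one_minus_inverse\<close>. The constant is read off
  as z tends to 1 along the upper unit semicircle, where z and 1/z both lie in the closed disc: 2
  pi^2/6 + (-i pi)^2/2 = -pi^2/6.\<close>

lemma dilog_slit_inversion:
  assumes z: "z \<notin> \<real>\<^sub>\<ge>\<^sub>0"
  shows "dilog_slit z = - dilog_slit (1 / z) - (of_real pi)\<^sup>2 / 6 - (ln (- z))\<^sup>2 / 2"
proof -
  have "dilog_slit z + dilog_slit (1 / z) + (ln (- z))\<^sup>2 / 2 = - (of_real pi)\<^sup>2 / 6"
  proof (rule constant_off_nonneg_Reals[OF _ _ _ _ z, where p = cis and F = "at_right 0"])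
    fix w :: complex assume w: "w \<notin> \<real>\<^sub>\<ge>\<^sub>0"
    note w' = not_nonneg_Reals_imp[OF w] not_nonneg_Reals_imp[OF not_nonneg_Reals_imp(5)[OF w]]
    show "((\<lambda>z. dilog_slit z + dilog_slit (1 / z) + (ln (- z))\<^sup>2 / 2) has_field_derivative 0) (at w)"
    proof (rule DERIV_cong)
      show "((\<lambda>z. dilog_slit z + dilog_slit (1 / z) + (ln (- z))\<^sup>2 / 2) has_field_derivative
          - ln (1 - w) / w * 1 + - ln (1 - 1 / w) / (1 / w) * (- 1 / w\<^sup>2) + ln (- w) / w) (at w)"
        using w' by (auto intro!: derivative_eq_intros simp: divide_simps power2_eq_square)
      show "- ln (1 - w) / w * 1 + - ln (1 - 1 / w) / (1 / w) * (- 1 / w\<^sup>2) + ln (- w) / w = 0"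
        unfolding ln_one_minus_inverse[OF w]
        using w' by (simp add: field_simps power2_eq_square)
    qed
  next
    have ev: "\<forall>\<^sub>F t in at_right 0. 0 < t \<and> t < pi"
      by (rule eventually_at_rightI[of 0 pi]) auto
    then show "\<forall>\<^sub>F t in at_right 0. cis t \<notin> \<real>\<^sub>\<ge>\<^sub>0"
      using sin_gt_zero by (auto simp: complex_nonneg_Reals_iff elim!: eventually_mono) fastforce
    have series: "((\<lambda>t. dilog_series (cis (h t))) \<longlongrightarrow> dilog_series (cis 0)) (at_right 0)"
      if "(h \<longlongrightarrow> 0) (at_right 0)" for h :: "real \<Rightarrow> real"
      by (rule continuous_on_tendsto_compose[OF continuous_on_dilog_series tendsto_cis[OF that]]) auto
    have "((\<lambda>t. dilog_series (cis t) + dilog_series (cis (- t)) + (of_real (t - pi) * \<i>)\<^sup>2 / 2)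
            \<longlongrightarrow> dilog_series (cis 0) + dilog_series (cis 0) + (of_real (0 - pi) * \<i>)\<^sup>2 / 2) (at_right 0)"
      by (intro tendsto_intros series) (auto intro!: tendsto_eq_intros)
    also have "dilog_series (cis 0) + dilog_series (cis 0) + (of_real (0 - pi) * \<i>)\<^sup>2 / 2
        = - (of_real pi)\<^sup>2 / 6"
      by (simp add: dilog_series_1 power2_eq_square field_simps)
    finally show "((\<lambda>t. dilog_slit (cis t) + dilog_slit (1 / cis t) + (ln (- cis t))\<^sup>2 / 2)
        \<longlongrightarrow> - (of_real pi)\<^sup>2 / 6) (at_right 0)"
    proof (rule Lim_transform_eventually)
      have "dilog_slit (cis s) = dilog_series (cis s)" if "sin s \<noteq> 0" for s
        using that by (intro dilog_series_eq_slit[symmetric]) (auto simp: complex_eq_iff)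
      \<comment> \<open>Subtracting pi, rather than adding it, keeps the argument in the principal
        range.\<close>
      moreover have "ln (- cis t) = of_real (t - pi) * \<i>" if "0 < t \<and> t < pi" for t
        using Ln_cis[of "t - pi"] that by (simp add: cis_divide[symmetric])
      moreover have "sin t \<noteq> 0" if "0 < t \<and> t < pi" for t
        using sin_gt_zero[of t] that by simp
      moreover have "1 / cis t = cis (- t)" for t
        by (simp add: cis_inverse[symmetric] field_simps)
      ultimately show "\<forall>\<^sub>F t in at_right 0. dilog_series (cis t) + dilog_series (cis (- t)) 
          + (of_real (t - pi) * \<i>)\<^sup>2 / 2 = dilog_slit (cis t) + dilog_slit (1 / cis t) + (ln (- cis t))\<^sup>2 / 2"
        using ev by (auto elim!: eventually_mono)
    qed
  qed simp
  then show ?thesis by (simp add: algebra_simps eq_neg_iff_add_eq_0)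
qed

text \<open>Off the cut inversion only changes the sign of the logarithm. For z > 1 the two squares
  would have opposite imaginary parts.\<close>

lemma ln_minus_inverse_sq:
  fixes z :: complex
  assumes "z \<notin> \<real>\<^sub>\<ge>\<^sub>0"
  shows "(ln (- (1 / z)))\<^sup>2 = (ln (- z))\<^sup>2"
  using Ln_inverse[OF not_nonneg_Reals_imp(3)[OF assms]] by (simp add: inverse_eq_divide)

lemma in_unit_interval_iff: "z \<in> complex_of_real ` {0..1} \<longleftrightarrow> Im z = 0 \<and> 0 \<le> Re z \<and> Re z \<le> 1"
  by (force simp: complex_eq_iff image_iff)

text \<open>Writing \<open>-1/z\<close> instead of \<open>-z\<close> under the logarithm makes the formula hold on the
  cut \<open>z > 1\<close> as well: both sides then take their boundary values from the upper half-plane.\<close>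

lemma dilog_inversion:
  assumes z: "z \<notin> complex_of_real ` {0..1}"
  shows "dilog z = - dilog (1 / z) - (of_real pi)\<^sup>2 / 6 - (ln (- (1 / z)))\<^sup>2 / 2"
proof (cases "z \<in> \<real>\<^sub>\<ge>\<^sub>0")
  case False
  note z' = not_nonneg_Reals_imp[OF False] not_nonneg_Reals_imp[OF not_nonneg_Reals_imp(5)[OF False]]
  show ?thesis
    using dilog_slit_inversion[OF False] z' by (simp add: dilog_eq_slit ln_minus_inverse_sq[OF False])
next
  case True
  with z obtain x where x: "z = of_real x" "x > 1"
    unfolding in_unit_interval_iff by (auto elim!: nonneg_Reals_cases)
  then have cut: "z \<in> dilog_cut" and cut': "1 / z \<notin> dilog_cut" and norm: "norm z > 1"
    by (auto simp: in_dilog_cut_iff)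
  let ?w = "\<lambda>t. z + of_real t * \<i>"
  have w: "(?w \<longlongrightarrow> z) (at_right 0)"
    by (auto intro!: tendsto_eq_intros)
  have pos: "\<forall>\<^sub>F t in at_right 0. (0::real) < t"
    by (rule eventually_at_rightI[of 0 1]) auto
  \<comment> \<open>With \<open>?w t\<close> also its negative reciprocal lies in the upper
    half-plane, so its logarithm tends to the principal value although the limit point is on the cut
    of \<open>ln\<close>.\<close>
  have "((\<lambda>t. - dilog_slit (1 / ?w t) - (of_real pi)\<^sup>2 / 6 - (ln (- (1 / ?w t)))\<^sup>2 / 2) \<longlongrightarrow>
        - dilog_slit (1 / z) - (of_real pi)\<^sup>2 / 6 - (ln (- (1 / z)))\<^sup>2 / 2) (at_right 0)"
    using x cut' pos
    by (intro tendsto_intros isCont_tendsto_compose[OF isCont_dilog_slit] tendsto_ln_upper w)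
       (auto simp: Im_divide elim!: eventually_mono)
  then have "((\<lambda>t. dilog_slit (?w t)) \<longlongrightarrow>
        - dilog_slit (1 / z) - (of_real pi)\<^sup>2 / 6 - (ln (- (1 / z)))\<^sup>2 / 2) (at_right 0)"
  proof (rule Lim_transform_eventually)
    show "\<forall>\<^sub>F t in at_right 0. - dilog_slit (1 / ?w t) - (of_real pi)\<^sup>2 / 6 - (ln (- (1 / ?w t)))\<^sup>2 / 2 
        = dilog_slit (?w t)"
      using pos
    proof eventually_elim
      case (elim t)
      then have "?w t \<notin> \<real>\<^sub>\<ge>\<^sub>0" using x by (simp add: complex_nonneg_Reals_iff)
      then show ?case using dilog_slit_inversion[of "?w t"] ln_minus_inverse_sq[of "?w t"] by simp
    qed
  qed
  then have "Lim (at_right 0) (\<lambda>t. dilog_slit (?w t)) = 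
      - dilog_slit (1 / z) - (of_real pi)\<^sup>2 / 6 - (ln (- (1 / z)))\<^sup>2 / 2"
    by (intro tendsto_Lim) simp_all
  moreover have "dilog z = Lim (at_right 0) (\<lambda>t. dilog_slit (?w t))"
    using norm cut by (simp add: dilog_def)
  ultimately show ?thesis using cut' by (simp add: dilog_eq_slit)
qed

section \<open>Continuity of real parts across the cuts and one-sided limits\<close>

text \<open>At the cut the argument jumps by changing sign; its modulus is a continuous function
  away from 0.\<close>

lemma abs_Im_ln: 
  fixes w :: complex
  assumes "w \<noteq> 0"
  shows "\<bar>Im (ln w)\<bar> = arccos (Re w / norm w)"
proof -
  have "Re w = exp (Re (ln w)) * cos (Im (ln w))"
    using Re_exp[of "ln w"] assms by simp
  also have "\<dots> = norm w * cos (Im (ln w))" using assms by simp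
  finally have "Re w / norm w = cos \<bar>Im (ln w)\<bar>" using assms by simp
  moreover have "arccos (cos \<bar>Im (ln w)\<bar>) = \<bar>Im (ln w)\<bar>"
    using mpi_less_Im_Ln[OF assms] Im_Ln_le_pi[OF assms] by (intro arccos_cos) auto
  ultimately show ?thesis by simp
qed

text \<open>The real part is the square of ln |w| minus the square of the argument, and the latter
  does not see the sign that jumps.\<close>

lemma isCont_Re_ln_sq:
  fixes z :: complex
  assumes z: "z \<noteq> 0"
  shows "isCont (\<lambda>w. Re ((ln w)\<^sup>2)) z"
proof -
  have bounds: "- norm w \<le> Re w" "Re w \<le> norm w" for w
    using abs_Re_le_cmod[of w] by linarith+
  have "((\<lambda>w. arccos (Re w / norm w)) \<longlongrightarrow> arccos (Re z / norm z)) (at z)"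
    by (rule continuous_on_tendsto_compose[OF continuous_on_arccos'])
       (use z in \<open>auto intro!: tendsto_intros always_eventually simp: bounds divide_le_eq le_divide_eq\<close>)
  then have "((\<lambda>w. (ln (norm w))\<^sup>2 - (arccos (Re w / norm w))\<^sup>2) \<longlongrightarrow> 
      (ln (norm z))\<^sup>2 - (arccos (Re z / norm z))\<^sup>2) (at z)"
    using z by (intro tendsto_intros) auto
  moreover have eq: "Re ((ln w)\<^sup>2) = (ln (norm w))\<^sup>2 - (arccos (Re w / norm w))\<^sup>2" if "w \<noteq> 0" for w
    using that by (simp add: abs_Im_ln[symmetric] power2_eq_square)
  ultimately show ?thesis
    unfolding isCont_def eq[OF z]
    by (elim Lim_transform_eventually)
       (use tendsto_imp_eventually_ne[OF tendsto_ident_at z] in eventually_elim, simp add: eq)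
qed

text \<open>Here even the imaginary part, 2 ln |w| times the argument, is continuous: the argument
  is bounded and ln |w| vanishes at -1. After inversion this settles the branch point 1 of the
  dilogarithm.\<close>

lemma isCont_ln_sq_minus_1: "isCont (\<lambda>w::complex. (ln w)\<^sup>2) (- 1)"
  unfolding isCont_def tendsto_complex_iff
proof
  show "((\<lambda>w. Re ((ln w)\<^sup>2)) \<longlongrightarrow> Re ((ln (- 1))\<^sup>2)) (at (- 1))"
    using isCont_Re_ln_sq[of "- 1"] by (simp add: isCont_def)
  have "((\<lambda>w::complex. 2 * \<bar>ln (norm w)\<bar> * pi) \<longlongrightarrow> 2 * \<bar>ln (norm (-1::complex))\<bar> * pi) (at (- 1))"
    by (intro tendsto_intros) auto
  then have lim: "((\<lambda>w::complex. 2 * \<bar>ln (norm w)\<bar> * pi) \<longlongrightarrow> 0) (at (- 1))"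
    by simp
  have "\<forall>\<^sub>F w in at (- 1). norm (Im ((ln w)\<^sup>2)) \<le> 2 * \<bar>ln (norm w)\<bar> * pi"
    using tendsto_imp_eventually_ne[OF tendsto_ident_at, of "-1::complex" 0]
  proof (rule eventually_mono)
    fix w :: complex assume w: "w \<noteq> 0"
    have "\<bar>Im (ln w)\<bar> \<le> pi"
      using mpi_less_Im_Ln[OF w] Im_Ln_le_pi[OF w] by simp
    then have "2 * \<bar>ln (norm w)\<bar> * \<bar>Im (ln w)\<bar> \<le> 2 * \<bar>ln (norm w)\<bar> * pi"
      by (intro mult_left_mono) auto
    then show "norm (Im ((ln w)\<^sup>2)) \<le> 2 * \<bar>ln (norm w)\<bar> * pi"
      using w by (simp add: power2_eq_square abs_mult mult_ac)
  qed simp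
  from Lim_null_comparison[OF this lim]
  show "((\<lambda>w. Im ((ln w)\<^sup>2)) \<longlongrightarrow> Im ((ln (- 1))\<^sup>2)) (at (- 1))"
    by (simp add: power2_eq_square)
qed

text \<open>At the branch point 1 the closed disc is handled by the series and its complement by
  inversion, which carries it into the disc.\<close>

lemma isCont_dilog:
  assumes "z \<notin> dilog_cut \<or> z = 1"
  shows "isCont dilog z"
proof (cases "z = 1")
  case False
  with assms have z: "z \<notin> dilog_cut" by simp
  have "isCont dilog z \<longleftrightarrow> isCont dilog_slit z"
    using z open_compl_dilog_cut dilog_eq_slit
    by (intro isCont_cong) (auto simp: eventually_nhds)
  with isCont_dilog_slit[OF z] show ?thesis by simp
next
  case True
  have dilog: "dilog z = dilog_series z" if "norm z \<le> 1" for z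
    using that by (simp add: dilog_def)
  have on: "continuous_on (cball 0 1) dilog"
    using continuous_on_dilog_series by (rule continuous_on_eq) (simp add: dilog)
  have inside: "(dilog \<longlongrightarrow> dilog 1) (at 1 within cball 0 1)"
    using on by (simp add: continuous_on_def)
  have inv: "((\<lambda>z. 1 / z) \<longlongrightarrow> (1::complex)) (at 1 within - cball 0 1)"
    by (auto intro!: tendsto_eq_intros)
  have "((\<lambda>z. - dilog (1 / z) - (of_real pi)\<^sup>2 / 6 - (ln (- (1 / z)))\<^sup>2 / 2) \<longlongrightarrow>
      - dilog 1 - (of_real pi)\<^sup>2 / 6 - (ln (- 1))\<^sup>2 / 2) (at 1 within - cball 0 1)"
    by (intro tendsto_intros continuous_on_tendsto_compose[OF on] 
          isCont_tendsto_compose[OF isCont_ln_sq_minus_1] inv)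
       (auto intro!: inv simp: eventually_at_filter norm_divide divide_le_eq)
  \<comment> \<open>Both sides match since -pi^2/6 - pi^2/6 + pi^2/2 = pi^2/6.\<close>
  also have "- dilog 1 - (of_real pi)\<^sup>2 / 6 - (ln (- 1))\<^sup>2 / 2 = dilog 1"
    by (simp add: dilog_1 power_mult_distrib field_simps)
  finally have outside: "(dilog \<longlongrightarrow> dilog 1) (at 1 within - cball 0 1)"
  proof (rule Lim_transform_eventually)
    show "\<forall>\<^sub>F z in at 1 within - cball 0 1. 
        - dilog (1 / z) - (of_real pi)\<^sup>2 / 6 - (ln (- (1 / z)))\<^sup>2 / 2 = dilog z"
      unfolding eventually_at_filter
      by (intro always_eventually allI impI dilog_inversion[symmetric]) auto
  qed
  from Lim_Un[OF inside outside] True show ?thesis by (simp add: isCont_def Compl_partition)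
qed

text \<open>On the open cut, inversion leads to 1/z inside the disc and to a squared logarithm whose
  real part is continuous.\<close>

lemma isCont_Re_dilog: "isCont (\<lambda>z. Re (dilog z)) z"
proof (cases "z \<notin> dilog_cut \<or> z = 1")
  case True
  then show ?thesis by (intro isCont_Re isCont_dilog)
next
  case False
  then have norm: "norm z > 1" using norm_gt_1_if_in_dilog_cut by blast
  then have "1 / z \<in> ball 0 1"
    by (simp add: norm_divide divide_less_eq)
  then have cut: "1 / z \<notin> dilog_cut"
    using ball_subset_compl_dilog_cut by blast
  have z: "z \<noteq> 0" using norm by auto
  have eq: "Re (dilog w) = - Re (dilog (1 / w)) - pi\<^sup>2 / 6 - Re ((ln (- (1 / w)))\<^sup>2) / 2"
    if "norm w > 1" for w
  proof -
    have "w \<notin> complex_of_real ` {0..1}" using that by auto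
    from arg_cong[OF dilog_inversion[OF this], of Re] show ?thesis
      by (simp flip: of_real_power)
  qed
  have "\<forall>\<^sub>F w in nhds z. norm w > 1"
    using norm by (intro eventually_nhds_in_open[of "{w. norm w > 1}", simplified] open_Collect_less continuous_intros)
  then have "isCont (\<lambda>z. Re (dilog z)) z \<longleftrightarrow> 
      isCont (\<lambda>w. - Re (dilog (1 / w)) - pi\<^sup>2 / 6 - Re ((ln (- (1 / w)))\<^sup>2) / 2) z"
    by (intro isCont_cong) (auto simp: eq elim: eventually_mono)
  moreover have "isCont (\<lambda>w. - Re (dilog (1 / w)) - pi\<^sup>2 / 6 - Re ((ln (- (1 / w)))\<^sup>2) / 2) z"
    by (intro continuous_intros isCont_Re isCont_o2[OF _ isCont_dilog] isCont_o2[OF _ isCont_Re_ln_sq])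
       (use z cut in auto)
  ultimately show ?thesis by simp
qed

text \<open>By the intermediate value theorem the curve stays on one side of the real axis. After
  inversion only the logarithm could jump at the cut, and it has a limit from each side.\<close>

lemma dilog_one_sided_limit:
  fixes f :: "real \<Rightarrow> complex"
  assumes e: "e > 0" and cont: "continuous_on {0<..<e} f"
    and Im: "\<And>b. b \<in> {0<..<e} \<Longrightarrow> Im (f b) \<noteq> 0"
    and f: "(f \<longlongrightarrow> z) (at_right 0)"
  shows "\<exists>l. ((\<lambda>b. dilog (f b)) \<longlongrightarrow> l) (at_right 0)"
proof (cases "z \<notin> dilog_cut \<or> z = 1")
  case True
  then show ?thesis using isCont_tendsto_compose[OF isCont_dilog f] by blast
next
  case False
  then have norm: "norm z > 1" using norm_gt_1_if_in_dilog_cut by blast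
  then have "1 / z \<in> ball 0 1"
    by (simp add: norm_divide divide_less_eq)
  then have cut: "1 / z \<notin> dilog_cut"
    using ball_subset_compl_dilog_cut by blast
  have z: "z \<noteq> 0" using norm by auto
  have ev: "\<forall>\<^sub>F b in at_right 0. b \<in> {0<..<e}"
    using e by (intro eventually_at_rightI[of 0 e]) auto
  have conn: "connected ((\<lambda>b. Im (f b)) ` {0<..<e})"
    by (intro connected_continuous_image continuous_intros cont) simp
  have sign: "(\<forall>b\<in>{0<..<e}. Im (f b) > 0) \<or> (\<forall>b\<in>{0<..<e}. Im (f b) < 0)"
  proof (rule ccontr)
    assume "\<not> ?thesis"
    then obtain b c where bc: "b \<in> {0<..<e}" "\<not> Im (f b) > 0" "c \<in> {0<..<e}" "\<not> Im (f c) < 0"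
      by blast
    then have "0 \<in> (\<lambda>b. Im (f b)) ` {0<..<e}"
      by (intro connectedD_interval[OF conn imageI[OF bc(1)] imageI[OF bc(3)]]) auto
    with Im show False by force
  qed
  have inv: "((\<lambda>b. - (1 / f b)) \<longlongrightarrow> - (1 / z)) (at_right 0)"
    by (intro tendsto_intros f z)
  \<comment> \<open>Taking the negative reciprocal preserves the side of the real axis.\<close>
  have Im_inv: "Im (- (1 / w)) = Im w / (norm w)\<^sup>2" for w
    by (simp add: Im_divide cmod_power2)
  have "\<exists>l. ((\<lambda>b. ln (- (1 / f b))) \<longlongrightarrow> l) (at_right 0)"
    using sign
  proof
    assume "\<forall>b\<in>{0<..<e}. Im (f b) > 0"
    then have "\<forall>b\<in>{0<..<e}. Im (- (1 / f b)) \<ge> 0"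
      unfolding Im_inv by (auto intro: less_imp_le)
    with ev have "\<forall>\<^sub>F b in at_right 0. Im (- (1 / f b)) \<ge> 0"
      by (auto elim: eventually_mono)
    then show ?thesis using tendsto_ln_upper[OF inv] z by auto
  next
    assume neg: "\<forall>b\<in>{0<..<e}. Im (f b) < 0"
    have "Im (- (1 / f b)) < 0" if "b \<in> {0<..<e}" for b
    proof -
      have "f b \<noteq> 0" using Im[OF that] by auto
      then show ?thesis unfolding Im_inv using neg that by (intro divide_neg_pos) auto
    qed
    with ev have "\<forall>\<^sub>F b in at_right 0. Im (- (1 / f b)) < 0"
      by (auto elim: eventually_mono)
    then show ?thesis using tendsto_ln_lower[OF inv] z by auto
  qed
  then obtain l where l: "((\<lambda>b. ln (- (1 / f b))) \<longlongrightarrow> l) (at_right 0)" ..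
  have "((\<lambda>b. - dilog (1 / f b) - (of_real pi)\<^sup>2 / 6 - (ln (- (1 / f b)))\<^sup>2 / 2) \<longlongrightarrow>
      - dilog (1 / z) - (of_real pi)\<^sup>2 / 6 - l\<^sup>2 / 2) (at_right 0)"
    using cut by (intro tendsto_intros isCont_tendsto_compose[OF isCont_dilog] l f z) auto
  then have "((\<lambda>b. dilog (f b)) \<longlongrightarrow>
      - dilog (1 / z) - (of_real pi)\<^sup>2 / 6 - l\<^sup>2 / 2) (at_right 0)"
  proof (rule Lim_transform_eventually)
    show "\<forall>\<^sub>F b in at_right 0. - dilog (1 / f b) - (of_real pi)\<^sup>2 / 6 - (ln (- (1 / f b)))\<^sup>2 / 2
        = dilog (f b)"
      using ev
    proof eventually_elim
      case (elim b)
      then have "f b \<notin> complex_of_real ` {0..1}" using Im[OF elim] by auto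
      then show ?case by (rule dilog_inversion[symmetric])
    qed
  qed
  then show ?thesis by blast
qed

section \<open>The three-term identity\<close>

lemma roots_not_in_unit_interval:
  assumes u: "u \<notin> \<real>\<^sub>\<ge>\<^sub>0" and sum: "x + y = 2 - u" and prod: "x * y = (1 - u)\<^sup>2"
  shows "x \<notin> complex_of_real ` {0..1}"
proof
  assume "x \<in> complex_of_real ` {0..1}"
  then obtain t where t: "x = of_real t" "0 \<le> t" "t \<le> 1" by auto
  define p q where "p = Re u" and "q = Im u"
  have u_eq: "u = Complex p q" by (simp add: p_def q_def)
  have "y = 2 - u - x" using sum by (simp add: algebra_simps)
  then have "x * (2 - u - x) = (1 - u)\<^sup>2" using prod by simp
  then have *: "t * (2 - p - t) = (1 - p)\<^sup>2 - q\<^sup>2" "t * q = 2 * (1 - p) * q"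
    by (simp_all add: complex_eq_iff t u_eq power2_eq_square algebra_simps)
  show False
  proof (cases "q = 0")
    case True
    with u have "p < 0" by (simp add: u_eq complex_nonneg_Reals_iff)
    \<comment> \<open>The quadratic at t, as a polynomial in -p > 0 with nonnegative
      coefficients.\<close>
    have "0 < p\<^sup>2 + (2 - t) * (- p) + (1 - t)\<^sup>2"
      using \<open>p < 0\<close> t by (intro add_pos_nonneg) (auto intro: mult_nonneg_nonpos)
    with *(1) True show False by (simp add: power2_eq_square algebra_simps)
  next
    case False
    with *(2) have "t = 2 * (1 - p)" by (metis mult_right_cancel)
    then have "p = (2 - t) / 2" by simp
    with *(1) have "4 * q\<^sup>2 = - (t * (4 - 3 * t))"
      by (simp add: power2_eq_square field_simps)
    moreover have "t * (4 - 3 * t) \<ge> 0" using t by (intro mult_nonneg_nonneg) auto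
    moreover have "q\<^sup>2 > 0" using False by simp
    ultimately show False by linarith
  qed
qed

lemma inverse_facts_off_unit_interval:
  assumes x: "x \<notin> complex_of_real ` {0..1}"
  shows "x \<noteq> 0" "x \<noteq> 1" "1 / x \<notin> dilog_cut" "1 - 1 / x \<notin> \<real>\<^sub>\<le>\<^sub>0"
proof -
  show "x \<noteq> 0" "x \<noteq> 1" using x by (auto simp: in_unit_interval_iff)
  show *: "1 / x \<notin> dilog_cut"
  proof
    assume "1 / x \<in> dilog_cut"
    then obtain r where r: "1 / x = of_real r" "r \<ge> 1" by (auto simp: dilog_cut_def)
    then have "x = of_real (1 / r)" using \<open>x \<noteq> 0\<close> by (auto simp: field_simps)
    with x r show False by (auto simp: in_unit_interval_iff)
  qed
  then show "1 - 1 / x \<notin> \<real>\<^sub>\<le>\<^sub>0" by (simp only: one_minus_nonpos_Reals_iff not_False_eq_True)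
qed

text \<open>\<open>s\<close> may be either square root of u (4 - 3 u), the discriminant of X^2 - (2
  - u) X + (1 - u)^2; so this serves both the principal roots and \<open>root_disc\<close>.\<close>

lemma root_sum_prod:
  fixes s u :: complex
  assumes "s\<^sup>2 = u * (4 - 3 * u)"
  shows "(2 - s - u) / 2 + (2 + s - u) / 2 = 2 - u"
    and "(2 - s - u) / 2 * ((2 + s - u) / 2) = (1 - u)\<^sup>2"
proof -
  show "(2 - s - u) / 2 + (2 + s - u) / 2 = 2 - u" by (simp add: field_simps)
  have "(2 - s - u) * (2 + s - u) = (2 - u)\<^sup>2 - s\<^sup>2"
    by (simp add: algebra_simps power2_eq_square)
  also have "\<dots> = 4 * (1 - u)\<^sup>2"
    unfolding assms by (simp add: algebra_simps power2_eq_square)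
  finally show "(2 - s - u) / 2 * ((2 + s - u) / 2) = (1 - u)\<^sup>2" by simp
qed

lemma root_off_unit_interval:
  assumes "s\<^sup>2 = u * (4 - 3 * u)" "u \<notin> \<real>\<^sub>\<ge>\<^sub>0"
  shows "(2 - s - u) / 2 \<notin> complex_of_real ` {0..1}"
  using roots_not_in_unit_interval[OF assms(2) root_sum_prod[OF assms(1)]] .

section \<open>Derivatives of the terms in the roots\<close>

text \<open>\<open>x'\<close> is the derivative of x, with s' = (2 - 3 u) / s from implicit
  differentiation of s^2. The two quotients are the derivatives of ln x and ln (1 - 1/x).\<close>

lemma root_log_derivative:
  fixes s u :: complex
  assumes sq: "s\<^sup>2 = u * (4 - 3 * u)" and nz: "s \<noteq> 0" "u \<noteq> 0" "u \<noteq> 1"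
  defines "x \<equiv> (2 - s - u) / 2" and "x' \<equiv> (- ((2 - 3 * u) / s) - 1) / 2"
  assumes x: "x \<noteq> 0" "x \<noteq> 1"
  shows "x' / x = - (1 + 1 / s) / (1 - u)"
    and "x' / (x * (x - 1)) = (1 / (2 * u) + 3 / (2 * s)) / (1 - u)"
proof -
  have x': "x' * (2 * s) = - (2 - 3 * u) - s" using nz by (simp add: x'_def field_simps)
  have x2: "2 * x = 2 - s - u" by (simp add: x_def)
  have u1: "1 - u \<noteq> 0" using nz by simp
  have "s * s = u * (4 - 3 * u)" using sq by (simp add: power2_eq_square)
  note facts = x' x2 this
  have "2 * s * (x' * (1 - u) + (1 + 1 / s) * x) = (1 - u) * (x' * (2 * s)) + (s + 1) * (2 * x)"
    using nz by (simp add: field_simps)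
  also have "\<dots> = 0" unfolding x' x2 using facts(3) by algebra
  finally have "x' * (1 - u) + (1 + 1 / s) * x = 0"
    using nz(1) by (metis mult_eq_0_iff zero_neq_numeral)
  then have "x' * (1 - u) = - (1 + 1 / s) * x"
    by (simp only: eq_neg_iff_add_eq_0 mult_minus_left)
  then show *: "x' / x = - (1 + 1 / s) / (1 - u)"
    using x u1 by (simp add: frac_eq_eq)
  have "2 * u * s * ((- (1 + 1 / s)) - (1 / (2 * u) + 3 / (2 * s)) * (x - 1)) 
      = - (2 * u * (s + 1)) - (s + 3 * u) * (x - 1)"
    using nz by (simp add: field_simps)
  also have "\<dots> = 0" using x2 facts(3) by algebra
  finally have "- (1 + 1 / s) = (1 / (2 * u) + 3 / (2 * s)) * (x - 1)" using nz by simp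
  then have "x' / x / (x - 1) = (1 / (2 * u) + 3 / (2 * s)) / (1 - u)"
    unfolding * using x by simp
  then show "x' / (x * (x - 1)) = (1 / (2 * u) + 3 / (2 * s)) / (1 - u)" by simp
qed

text \<open>\<open>s\<close> is any differentiable branch of the root; taking
  \<open>root_disc\<close> and its negative covers both roots of the quadratic.\<close>

lemma root_has_field_derivative:
  fixes s :: "complex \<Rightarrow> complex"
  assumes s: "(s has_field_derivative (2 - 3 * u) / s u) (at u)"
    and sq: "(s u)\<^sup>2 = u * (4 - 3 * u)" and u: "u \<notin> \<real>\<^sub>\<ge>\<^sub>0"
  defines "x \<equiv> \<lambda>v. (2 - s v - v) / 2"
  shows "((\<lambda>v. ln (1 - 1 / x v)) has_field_derivative (1 / (2 * u) + 3 / (2 * s u)) / (1 - u)) (at u)"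
    and "((\<lambda>v. dilog_slit (1 / x v)) has_field_derivative
            - ln (1 - 1 / x u) * (1 + 1 / s u) / (1 - u)) (at u)"
proof -
  have nz: "u \<noteq> 0" "u \<noteq> 1" using not_nonneg_Reals_imp[OF u] by auto
  have "4 - 3 * u \<noteq> 0"
  proof
    assume "4 - 3 * u = 0"
    then have "u = of_real (4 / 3)" by (simp add: field_simps)
    with u show False by (simp add: nonneg_Reals_of_real_iff)
  qed
  with nz sq have s0: "s u \<noteq> 0" by auto
  have x: "x u \<notin> complex_of_real ` {0..1}"
    unfolding x_def by (rule root_off_unit_interval[OF sq u])
  note x' = inverse_facts_off_unit_interval[OF x]
  let ?d = "(- ((2 - 3 * u) / s u) - 1) / 2"
  have D: "(x has_field_derivative ?d) (at u)"
    unfolding x_def by (auto intro!: derivative_eq_intros s)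
  have xu: "x u = (2 - s u - u) / 2" by (simp add: x_def)
  note ld = root_log_derivative[OF sq s0 nz, folded xu, OF x'(1,2)]
  show "((\<lambda>v. ln (1 - 1 / x v)) has_field_derivative (1 / (2 * u) + 3 / (2 * s u)) / (1 - u)) (at u)"
  proof (rule DERIV_cong)
    show "((\<lambda>v. ln (1 - 1 / x v)) has_field_derivative (?d / (x u)\<^sup>2) / (1 - 1 / x u)) (at u)"
      using x' by (auto intro!: derivative_eq_intros D simp: field_simps power2_eq_square)
    have "(?d / (x u)\<^sup>2) / (1 - 1 / x u) = ?d / (x u * (x u - 1))"
      using x' by (simp add: divide_simps power2_eq_square)
    also note ld(2)
    finally show "(?d / (x u)\<^sup>2) / (1 - 1 / x u) = (1 / (2 * u) + 3 / (2 * s u)) / (1 - u)" .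
  qed
  show "((\<lambda>v. dilog_slit (1 / x v)) has_field_derivative
            - ln (1 - 1 / x u) * (1 + 1 / s u) / (1 - u)) (at u)"
  proof (rule DERIV_cong)
    show "((\<lambda>v. dilog_slit (1 / x v)) has_field_derivative ln (1 - 1 / x u) * (?d / x u)) (at u)"
    proof (rule DERIV_cong)
      have "((\<lambda>v. 1 / x v) has_field_derivative - ?d / (x u)\<^sup>2) (at u)"
        using x' by (auto intro!: derivative_eq_intros D simp: power2_eq_square)
      then show "((\<lambda>v. dilog_slit (1 / x v)) has_field_derivative
          - ln (1 - 1 / x u) / (1 / x u) * (- ?d / (x u)\<^sup>2)) (at u)"
        using x' by (intro has_field_derivative_dilog_slit_compose) auto
      have "- l / (1 / z) * (- d / z\<^sup>2) = l * (d / z)" if "z \<noteq> 0" for l d z :: complex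
        using that by (simp add: power2_eq_square)
      then show "- ln (1 - 1 / x u) / (1 / x u) * (- ?d / (x u)\<^sup>2) = ln (1 - 1 / x u) * (?d / x u)"
        using x'(1) by blast
    qed
    show "ln (1 - 1 / x u) * (?d / x u) = - ln (1 - 1 / x u) * (1 + 1 / s u) / (1 - u)"
      unfolding ld(1) by (simp only: times_divide_eq_right mult_minus_left mult_minus_right)
  qed
qed

text \<open>Agrees with \<open>csqrt (4 - 3 * u) * csqrt u\<close> up to sign, but is holomorphic across the
  negative real axis.\<close>

definition root_disc :: "complex \<Rightarrow> complex" where
  "root_disc u = \<i> * csqrt (4 - 3 * u) * csqrt (- u)"

lemma root_disc_sq: "(root_disc u)\<^sup>2 = u * (4 - 3 * u)"
  by (simp add: root_disc_def power_mult_distrib algebra_simps)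

lemma has_field_derivative_root_disc:
  assumes u: "u \<notin> \<real>\<^sub>\<ge>\<^sub>0"
  shows "(root_disc has_field_derivative (2 - 3 * u) / root_disc u) (at u)"
proof -
  have "4 - 3 * u \<notin> \<real>\<^sub>\<le>\<^sub>0" "- u \<notin> \<real>\<^sub>\<le>\<^sub>0"
    using u by (auto simp: complex_nonneg_Reals_iff complex_nonpos_Reals_iff)
  moreover from this have nz: "csqrt (4 - 3 * u) \<noteq> 0" "csqrt (- u) \<noteq> 0" by force+
  ultimately have "(root_disc has_field_derivative \<i> * (- 3 / (2 * csqrt (4 - 3 * u)) * csqrt (- u)
      + csqrt (4 - 3 * u) * (- 1 / (2 * csqrt (- u))))) (at u)"
    unfolding root_disc_def by (auto intro!: derivative_eq_intros simp: field_simps)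
  moreover have "\<i> * (- 3 / (2 * a) * b + a * (- 1 / (2 * b))) = (2 - 3 * u) / (\<i> * a * b)"
    if "a * a = 4 - 3 * u" "b * b = - u" "a \<noteq> 0" "b \<noteq> 0" for a b
  proof -
    have "\<i> * (- 3 / (2 * a) * b + a * (- 1 / (2 * b))) * (\<i> * a * b) = (3 * (b * b) + a * a) / 2"
      using that(3,4) by (simp add: field_simps)
    also have "\<dots> = 2 - 3 * u" unfolding that(1,2) by simp
    finally show ?thesis using that(3,4) by (simp add: eq_divide_eq mult_ac)
  qed
  ultimately show ?thesis
    using nz unfolding root_disc_def
    by (metis (no_types, lifting) power2_csqrt power2_eq_square)
qed

lemma root_deriv:
  fixes u :: complex
  assumes u: "u \<notin> \<real>\<^sub>\<ge>\<^sub>0"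
  shows "((\<lambda>v. ln (1 - 1 / ((2 - root_disc v - v) / 2))) has_field_derivative
            (1 / (2 * u) + 3 / (2 * root_disc u)) / (1 - u)) (at u)"
    and "((\<lambda>v. ln (1 - 1 / ((2 + root_disc v - v) / 2))) has_field_derivative
            (1 / (2 * u) - 3 / (2 * root_disc u)) / (1 - u)) (at u)"
    and "((\<lambda>v. dilog_slit (1 / ((2 - root_disc v - v) / 2))) has_field_derivative
            - ln (1 - 1 / ((2 - root_disc u - u) / 2)) * (1 + 1 / root_disc u) / (1 - u)) (at u)"
    and "((\<lambda>v. dilog_slit (1 / ((2 + root_disc v - v) / 2))) has_field_derivative
            - ln (1 - 1 / ((2 + root_disc u - u) / 2)) * (1 - 1 / root_disc u) / (1 - u)) (at u)"
proof -
  note D = has_field_derivative_root_disc[OF u]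
  have D': "((\<lambda>v. - root_disc v) has_field_derivative (2 - 3 * u) / (- root_disc u)) (at u)"
    using DERIV_minus[OF D] by simp
  have sq': "(- root_disc u)\<^sup>2 = u * (4 - 3 * u)" by (simp add: root_disc_sq)
  note R = root_has_field_derivative[OF D root_disc_sq u]
  note R' = root_has_field_derivative[OF D' sq' u]
  show "((\<lambda>v. ln (1 - 1 / ((2 - root_disc v - v) / 2))) has_field_derivative
            (1 / (2 * u) + 3 / (2 * root_disc u)) / (1 - u)) (at u)" by (rule R(1))
  show "((\<lambda>v. dilog_slit (1 / ((2 - root_disc v - v) / 2))) has_field_derivative
            - ln (1 - 1 / ((2 - root_disc u - u) / 2)) * (1 + 1 / root_disc u) / (1 - u)) (at u)"
    by (rule R(2))
  show "((\<lambda>v. ln (1 - 1 / ((2 + root_disc v - v) / 2))) has_field_derivative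
            (1 / (2 * u) - 3 / (2 * root_disc u)) / (1 - u)) (at u)"
    using R'(1) by simp
  show "((\<lambda>v. dilog_slit (1 / ((2 + root_disc v - v) / 2))) has_field_derivative
            - ln (1 - 1 / ((2 + root_disc u - u) / 2)) * (1 - 1 / root_disc u) / (1 - u)) (at u)"
    using R'(2) by simp
qed

section \<open>Asymptotics at the origin\<close>

text \<open>Along u = -t both roots tend to 1 and their logarithms diverge like
  \<open>ln (sqrt t)\<close>; \<open>\<sigma>\<close> selects the root and decides the sign of the
  finite part.\<close>

lemma root_asymptotics:
  fixes \<sigma> :: complex
  assumes \<sigma>: "\<sigma> = 1 \<or> \<sigma> = - 1"
  defines "x \<equiv> \<lambda>t::real. (2 - \<sigma> * root_disc (- of_real t) + of_real t) / 2"
  shows "(x \<longlongrightarrow> 1) (at_right 0)"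
    and "((\<lambda>t. ln (1 - 1 / x t) - of_real (ln (sqrt t))) \<longlongrightarrow> - \<sigma> * (\<i> * of_real pi / 2)) (at_right 0)"
proof -
  have pos: "\<forall>\<^sub>F t in at_right (0::real). t > 0"
    by (rule eventually_at_rightI[of 0 1]) auto
  \<comment> \<open>From 2 (x - 1) = sqrt t (sqrt t - \<sigma> i sqrt (4 + 3 t)) follows 1 - 1/x =
    sqrt t * w; a positive factor splits off the logarithm without a change of branch.\<close>
  define w where "w t = (of_real (sqrt t) - \<sigma> * \<i> * of_real (sqrt (4 + 3 * t))) / (2 * x t)" for t
  have disc: "root_disc (- of_real t) = \<i> * of_real (sqrt (4 + 3 * t)) * of_real (sqrt t)" if "t > 0" for t
  proof -
    have "csqrt (of_real (4 + 3 * t)) = of_real (sqrt (4 + 3 * t))"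
      using that by (intro of_real_sqrt[symmetric]) auto
    then show ?thesis using that by (simp add: root_disc_def csqrt_of_real_nonneg)
  qed
  have "((\<lambda>t. (2 - \<sigma> * (\<i> * of_real (sqrt (4 + 3 * t)) * of_real (sqrt t)) + complex_of_real t) / 2)
      \<longlongrightarrow> (2 - \<sigma> * (\<i> * of_real (sqrt (4 + 3 * 0)) * of_real (sqrt 0)) + complex_of_real 0) / 2) (at_right 0)"
    by (intro tendsto_intros) auto
  also have "(2 - \<sigma> * (\<i> * of_real (sqrt (4 + 3 * 0)) * of_real (sqrt 0)) + complex_of_real 0) / 2 = 1"
    by simp
  finally show x: "(x \<longlongrightarrow> 1) (at_right 0)"
    by (rule Lim_transform_eventually) (rule eventually_mono[OF pos], simp add: x_def disc)
  have w: "(w \<longlongrightarrow> (of_real (sqrt 0) - \<sigma> * \<i> * of_real (sqrt (4 + 3 * 0))) / (2 * 1)) (at_right 0)"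
    unfolding w_def by (intro tendsto_intros x) auto
  have w0: "(of_real (sqrt 0) - \<sigma> * \<i> * of_real (sqrt (4 + 3 * 0))) / (2 * 1) = - \<sigma> * \<i>"
    by simp
  have w: "(w \<longlongrightarrow> - \<sigma> * \<i>) (at_right 0)" using w unfolding w0 .
  have "- \<sigma> * \<i> \<notin> \<real>\<^sub>\<le>\<^sub>0" using \<sigma> by (auto simp: complex_nonpos_Reals_iff)
  then have lnw: "((\<lambda>t. ln (w t)) \<longlongrightarrow> ln (- \<sigma> * \<i>)) (at_right 0)"
    by (intro tendsto_intros w)
  have ln_eq: "ln (- \<sigma> * \<i>) = - \<sigma> * (\<i> * of_real pi / 2)"
    using \<sigma> by auto
  show "((\<lambda>t. ln (1 - 1 / x t) - of_real (ln (sqrt t))) \<longlongrightarrow> - \<sigma> * (\<i> * of_real pi / 2)) (at_right 0)"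
    using lnw unfolding ln_eq
  proof (rule Lim_transform_eventually)
    have nz: "\<forall>\<^sub>F t in at_right 0. x t \<noteq> 0 \<and> w t \<noteq> 0"
      using tendsto_imp_eventually_ne[OF x, of 0] tendsto_imp_eventually_ne[OF w, of 0] \<sigma>
      by (auto intro: eventually_conj)
    show "\<forall>\<^sub>F t in at_right 0. ln (w t) = ln (1 - 1 / x t) - of_real (ln (sqrt t))"
      using pos nz
    proof eventually_elim
      case (elim t)
      have "of_real (sqrt t) * of_real (sqrt t) = complex_of_real t"
        using elim by (simp flip: of_real_mult)
      moreover have "2 * x t = 2 - \<sigma> * (\<i> * of_real (sqrt (4 + 3 * t)) * of_real (sqrt t)) + of_real t"
        using elim by (simp add: x_def disc)
      ultimately have "2 * (x t - 1) = of_real (sqrt t) * 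
          (of_real (sqrt t) - \<sigma> * \<i> * of_real (sqrt (4 + 3 * t)))"
        by (simp add: algebra_simps)
      moreover have "1 - 1 / x t = 2 * (x t - 1) / (2 * x t)"
        using elim by (simp add: field_simps)
      ultimately have "1 - 1 / x t = of_real (sqrt t) * w t"
        by (simp only: w_def times_divide_eq_right)
      then show ?case using elim by (simp add: Ln_times_of_real Ln_of_real[of "sqrt t"])
    qed
  qed
qed

section \<open>The logarithmic and the dilogarithmic relation\<close>

text \<open>The sum and product of the roots give (1 - 1/x)(1 - 1/y) = -u / (1 - u), so the
  logarithms agree up to a multiple of 2 pi i. It is 0, because the finite parts -i pi/2 and i pi/2
  cancel as u tends to 0.\<close>

lemma ln_sum_relation:
  assumes u: "u \<notin> \<real>\<^sub>\<ge>\<^sub>0"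
  shows "ln (1 - 1 / ((2 - root_disc u - u) / 2)) + ln (1 - 1 / ((2 + root_disc u - u) / 2))
    = ln (- u) - ln (1 - u)"
proof -
  have "ln (1 - 1 / ((2 - root_disc u - u) / 2)) + ln (1 - 1 / ((2 + root_disc u - u) / 2))
    + ln (1 - u) - ln (- u) = 0"
  proof (rule constant_off_nonneg_Reals[OF _ _ _ _ u, 
        where p = "\<lambda>t::real. - of_real t" and F = "at_right 0"])
    fix u :: complex assume u: "u \<notin> \<real>\<^sub>\<ge>\<^sub>0"
    note u' = not_nonneg_Reals_imp[OF u]
    have "((\<lambda>u. ln (1 - 1 / ((2 - root_disc u - u) / 2)) + ln (1 - 1 / ((2 + root_disc u - u) / 2))
      + ln (1 - u) - ln (- u)) has_field_derivative (1 / (2 * u) + 3 / (2 * root_disc u)) / (1 - u)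
        + (1 / (2 * u) - 3 / (2 * root_disc u)) / (1 - u) + - 1 / (1 - u) - 1 / u) (at u)"
      by (intro DERIV_add DERIV_diff root_deriv[OF u]) 
        (use u' in \<open>auto intro!: derivative_eq_intros simp: inverse_eq_divide\<close>)
    moreover have "(1 / (2 * u) + r) / (1 - u) + (1 / (2 * u) - r) / (1 - u) + - 1 / (1 - u) - 1 / u = 0" for r
    proof -
      have "(1 / (2 * u) + r) / (1 - u) + (1 / (2 * u) - r) / (1 - u) = 1 / u / (1 - u)"
        by (simp flip: add_divide_distrib)
      moreover have "1 / u / (1 - u) + - 1 / (1 - u) - 1 / u = 0"
        using u'(1,2) by (simp add: divide_simps)
      ultimately show ?thesis by simp
    qed
    ultimately show "((\<lambda>u. ln (1 - 1 / ((2 - root_disc u - u) / 2)) + ln (1 - 1 / ((2 + root_disc u - u) / 2))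
      + ln (1 - u) - ln (- u)) has_field_derivative 0) (at u)" by simp
  next
    have pos: "\<forall>\<^sub>F t in at_right (0::real). t > 0"
      by (rule eventually_at_rightI[of 0 1]) auto
    then show "\<forall>\<^sub>F t in at_right 0. - complex_of_real t \<notin> \<real>\<^sub>\<ge>\<^sub>0"
      by (auto simp: complex_nonneg_Reals_iff elim: eventually_mono)
    have ln1: "((\<lambda>t::real. ln (1 + of_real t)) \<longlongrightarrow> ln (1 + of_real 0 :: complex)) (at_right 0)"
      by (intro tendsto_intros) auto
    from tendsto_add[OF tendsto_add[OF root_asymptotics(2)[of 1] root_asymptotics(2)[of "- 1"]] ln1]
    have "((\<lambda>t. ln (1 - 1 / ((2 - root_disc (- of_real t) + of_real t) / 2)) - of_real (ln (sqrt t))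
      + (ln (1 - 1 / ((2 + root_disc (- of_real t) + of_real t) / 2)) - of_real (ln (sqrt t)))
      + ln (1 + of_real t)) \<longlongrightarrow> 0) (at_right 0)" by simp
    then show "((\<lambda>t. ln (1 - 1 / ((2 - root_disc (- of_real t) - (- of_real t)) / 2)) + 
        ln (1 - 1 / ((2 + root_disc (- of_real t) - (- of_real t)) / 2))
      + ln (1 - (- complex_of_real t)) - ln (- (- complex_of_real t))) \<longlongrightarrow> 0) (at_right 0)"
      by (rule Lim_transform_eventually)
         (use pos in \<open>auto elim!: eventually_mono simp: Ln_of_real ln_sqrt\<close>)
  qed simp
  then show ?thesis by (simp add: algebra_simps)
qed


text \<open>In the derivative of the difference the terms with 1 / \<open>root_disc\<close> cancel,
  and the rest contains the two root logarithms only through their sum, known from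
  \<open>ln_sum_relation\<close>.\<close>

lemma three_term_root_disc:
  assumes u: "u \<notin> \<real>\<^sub>\<ge>\<^sub>0"
  defines "x \<equiv> (2 - root_disc u - u) / 2" and "y \<equiv> (2 + root_disc u - u) / 2"
  shows "dilog_slit u - dilog_slit (1 / x) - dilog_slit (1 / y) =
    ((ln (1 - 1 / x))\<^sup>2 + (ln (1 - 1 / y))\<^sup>2 - 2 * ln (1 - u) * ln (- u)
       + (ln (1 - u))\<^sup>2 - (ln (- u))\<^sup>2 / 2) / 3 - (of_real pi)\<^sup>2 / 6"
proof -
  define X where "X v = (2 - root_disc v - v) / 2" for v
  define Y where "Y v = (2 + root_disc v - v) / 2" for v
  define A where "A v = ln (1 - 1 / X v)" for v
  define B where "B v = ln (1 - 1 / Y v)" for v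
  define P where "P v = ln (1 - v)" for v :: complex
  define Q where "Q v = ln (- v)" for v :: complex
  define h where "h v = dilog_slit v - dilog_slit (1 / X v) - dilog_slit (1 / Y v)
    - ((A v)\<^sup>2 + (B v)\<^sup>2 - 2 * P v * Q v + (P v)\<^sup>2 - (Q v)\<^sup>2 / 2) / 3" for v
  have AB: "A v + B v = Q v - P v" if "v \<notin> \<real>\<^sub>\<ge>\<^sub>0" for v
    using ln_sum_relation[OF that] by (simp add: A_def B_def P_def Q_def X_def Y_def)
  have "h u = - (of_real pi)\<^sup>2 / 6"
  proof (rule constant_off_nonneg_Reals[OF _ _ _ _ u, 
        where p = "\<lambda>t::real. - of_real t" and F = "at_right 0"])
    fix u :: complex assume u: "u \<notin> \<real>\<^sub>\<ge>\<^sub>0"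
    note u' = not_nonneg_Reals_imp[OF u]
    define r where "r = 1 / root_disc u"
    have slit: "(dilog_slit has_field_derivative - P u / u) (at u)"
      using has_field_derivative_dilog_slit[OF u'(4)] u'(1) by (simp add: P_def)
    have r3: "3 / (2 * root_disc u) = 3 * r / 2" by (simp add: r_def)
    have dA: "(A has_field_derivative (1 / (2 * u) + 3 * r / 2) / (1 - u)) (at u)"
      and dB: "(B has_field_derivative (1 / (2 * u) - 3 * r / 2) / (1 - u)) (at u)"
      using root_deriv(1,2)[OF u] unfolding A_def B_def X_def Y_def r3 by blast+
    have dX: "((\<lambda>v. dilog_slit (1 / X v)) has_field_derivative - A u * (1 + r) / (1 - u)) (at u)"
      and dY: "((\<lambda>v. dilog_slit (1 / Y v)) has_field_derivative - B u * (1 - r) / (1 - u)) (at u)"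
      using root_deriv(3,4)[OF u] by (simp_all add: A_def B_def X_def Y_def r_def)
    have dP: "(P has_field_derivative - 1 / (1 - u)) (at u)"
      and dQ: "(Q has_field_derivative 1 / u) (at u)"
      unfolding P_def Q_def using u' by (auto intro!: derivative_eq_intros simp: inverse_eq_divide)
    have sq: "((\<lambda>v. (f v)\<^sup>2) has_field_derivative 2 * f u * f') (at u)"
      if "(f has_field_derivative f') (at u)" for f :: "complex \<Rightarrow> complex" and f'
      by (rule DERIV_cong[OF DERIV_power[OF that, of 2]]) simp
    have dPQ: "((\<lambda>v. 2 * P v * Q v) has_field_derivative
        2 * (- 1 / (1 - u) * Q u + P u * (1 / u))) (at u)"
      by (rule DERIV_cong[OF DERIV_mult[OF DERIV_cmult[OF dP, of 2] dQ]]) (simp add: algebra_simps)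
    have dQ2: "((\<lambda>v. (Q v)\<^sup>2 / 2) has_field_derivative Q u * (1 / u)) (at u)"
      by (rule DERIV_cong[OF DERIV_cdivide[OF sq[OF dQ]]]) simp
    have hd: "(h has_field_derivative
        - P u / u - - A u * (1 + r) / (1 - u) - - B u * (1 - r) / (1 - u)
        - (2 * A u * ((1 / (2 * u) + 3 * r / 2) / (1 - u)) + 2 * B u * ((1 / (2 * u) - 3 * r / 2) / (1 - u))
           - 2 * (- 1 / (1 - u) * Q u + P u * (1 / u)) + 2 * P u * (- 1 / (1 - u)) - Q u * (1 / u)) / 3) (at u)"
      (is "(_ has_field_derivative ?D) _")
      unfolding h_def 
      by (intro DERIV_diff DERIV_add DERIV_cdivide sq dPQ dQ2 slit dA dB dX dY dP)
    \<comment> \<open>The partial fraction relation U M = U + M and the value of A + B reduce the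
      vanishing of the derivative to polynomial algebra.\<close>
    define U M where "U = 1 / u" and "M = 1 / (1 - u)"
    have UM: "U * M = U + M"
      using u'(1,2) by (simp add: U_def M_def divide_simps)
    have div: "z / u = z * U" "z / (1 - u) = z * M" "1 / (2 * u) = U / 2" for z
      by (simp_all add: U_def M_def)
    have "3 * ?D = - 3 * P u * U + 3 * A u * (1 + r) * M + 3 * B u * (1 - r) * M
        - (A u * (U + 3 * r) * M + B u * (U - 3 * r) * M + 2 * M * Q u - 2 * P u * U - 2 * P u * M - Q u * U)"
      unfolding div by (simp add: field_simps)
    also have "\<dots> = 0"
      using UM AB[OF u] by algebra
    finally have "?D = 0" by (simp only: mult_eq_0_iff) simp
    with hd show "(h has_field_derivative 0) (at u)" by (rule DERIV_cong)
  next
    have pos: "\<forall>\<^sub>F t in at_right (0::real). t > 0"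
      by (rule eventually_at_rightI[of 0 1]) auto
    show ev: "\<forall>\<^sub>F t in at_right 0. - complex_of_real t \<notin> \<real>\<^sub>\<ge>\<^sub>0"
      using pos by (auto simp: complex_nonneg_Reals_iff elim: eventually_mono)
    let ?m = "\<lambda>t::real. - complex_of_real t"
    \<comment> \<open>\<open>a\<close> and \<open>b\<close> are the root logarithms freed of their
      divergent part.\<close>
    define a where "a t = A (?m t) - of_real (ln (sqrt t))" for t
    define b where "b t = B (?m t) - of_real (ln (sqrt t))" for t
    have x: "((\<lambda>t. X (?m t)) \<longlongrightarrow> 1) (at_right 0)" and y: "((\<lambda>t. Y (?m t)) \<longlongrightarrow> 1) (at_right 0)"
      and a: "(a \<longlongrightarrow> - (\<i> * of_real pi / 2)) (at_right 0)"
      and b: "(b \<longlongrightarrow> \<i> * of_real pi / 2) (at_right 0)"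
      using root_asymptotics[of 1] root_asymptotics[of "- 1"] 
      by (simp_all add: X_def Y_def A_def B_def a_def[abs_def] b_def[abs_def])
    have "((\<lambda>t::real. ln (1 + t) * ln (sqrt t)) \<longlongrightarrow> 0) (at_right 0)"
      and "((\<lambda>t::real. ln (1 + t)) \<longlongrightarrow> 0) (at_right 0)"
      by real_asymp+
    from this[THEN tendsto_of_real, where ?'a = complex]
    have PL: "((\<lambda>t. of_real (ln (1 + t)) * complex_of_real (ln (sqrt t))) \<longlongrightarrow> 0) (at_right 0)" 
      and Pl: "((\<lambda>t. complex_of_real (ln (1 + t))) \<longlongrightarrow> 0) (at_right 0)"
      by simp_all
    \<comment> \<open>\<open>dilog\<close> replaces \<open>dilog_slit\<close>, which is not
      determined at 1, the limit of both inverse roots. The limit is -2 pi^2/6 + (pi^2/2)/3 =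
      -pi^2/6.\<close>
    have "((\<lambda>t. dilog (?m t) - dilog (1 / X (?m t)) - dilog (1 / Y (?m t))
        - ((a t)\<^sup>2 + (b t)\<^sup>2 - 6 * (of_real (ln (1 + t)) * of_real (ln (sqrt t)))
            + (of_real (ln (1 + t)))\<^sup>2) / 3) \<longlongrightarrow>
        dilog (- of_real 0) - dilog (1 / 1) - dilog (1 / 1) 
        - ((- (\<i> * of_real pi / 2))\<^sup>2 + (\<i> * of_real pi / 2)\<^sup>2 - 6 * 0 + 0\<^sup>2) / 3) (at_right 0)"
      by (intro tendsto_intros isCont_tendsto_compose[OF isCont_dilog] x y a b PL Pl)
         (auto simp: in_dilog_cut_iff)
    also have "dilog (- of_real 0) - dilog (1 / 1) - dilog (1 / 1) 
        - ((- (\<i> * of_real pi / 2))\<^sup>2 + (\<i> * of_real pi / 2)\<^sup>2 - 6 * 0 + 0\<^sup>2) / 3 = - (of_real pi)\<^sup>2 / 6"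
      by (simp add: dilog_0 dilog_1 power_mult_distrib power_divide field_simps)
    finally show "((\<lambda>t. h (?m t)) \<longlongrightarrow> - (of_real pi)\<^sup>2 / 6) (at_right 0)"
    proof (rule Lim_transform_eventually)
      show "\<forall>\<^sub>F t in at_right 0. dilog (?m t) - dilog (1 / X (?m t)) - dilog (1 / Y (?m t))
        - ((a t)\<^sup>2 + (b t)\<^sup>2 - 6 * (of_real (ln (1 + t)) * of_real (ln (sqrt t)))
            + (of_real (ln (1 + t)))\<^sup>2) / 3 = h (?m t)"
        using pos ev
      proof eventually_elim
        case (elim t)
        have sq: "(root_disc (?m t))\<^sup>2 = ?m t * (4 - 3 * ?m t)" 
          and sq': "(- root_disc (?m t))\<^sup>2 = ?m t * (4 - 3 * ?m t)" by (simp_all add: root_disc_sq)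
        have "X (?m t) \<notin> complex_of_real ` {0..1}" "Y (?m t) \<notin> complex_of_real ` {0..1}"
          using root_off_unit_interval[OF sq elim(2)] root_off_unit_interval[OF sq' elim(2)]
          by (simp_all add: X_def Y_def)
        then have cuts: "1 / X (?m t) \<notin> dilog_cut" "1 / Y (?m t) \<notin> dilog_cut"
          by (simp_all add: inverse_facts_off_unit_interval)
        define L where "L = complex_of_real (ln (sqrt t))"
        have "complex_of_real (ln t) = 2 * L"
          using elim by (simp add: L_def ln_sqrt)
        then have Q: "Q (?m t) = 2 * L" using elim by (simp add: Q_def Ln_of_real)
        have P: "P (?m t) = of_real (ln (1 + t))"
          using elim Ln_of_real[of "1 + t"] by (simp add: P_def)
        have ab: "a t + b t = - P (?m t)"
          using AB[OF elim(2)] by (simp add: a_def b_def Q flip: L_def)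
        have "A (?m t) = a t + L" "B (?m t) = b t + L" by (simp_all add: a_def b_def L_def)
        \<comment> \<open>The divergent squares cancel, 2 L^2 - (2 L)^2/2 = 0; what remains of L is
          multiplied by P or by a + b = -P, and P L tends to 0.\<close>
        then have "(A (?m t))\<^sup>2 + (B (?m t))\<^sup>2 - 2 * P (?m t) * Q (?m t) + (P (?m t))\<^sup>2 - (Q (?m t))\<^sup>2 / 2
            = (a t)\<^sup>2 + (b t)\<^sup>2 + 2 * L * (a t + b t) - 4 * (P (?m t) * L) + (P (?m t))\<^sup>2"
          by (simp add: Q power2_eq_square algebra_simps)
        also have "\<dots> = (a t)\<^sup>2 + (b t)\<^sup>2 - 6 * (P (?m t) * L) + (P (?m t))\<^sup>2"
          unfolding ab by (simp add: algebra_simps)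
        finally have sum_eq: "(A (?m t))\<^sup>2 + (B (?m t))\<^sup>2 - 2 * P (?m t) * Q (?m t) + (P (?m t))\<^sup>2
            - (Q (?m t))\<^sup>2 / 2 = (a t)\<^sup>2 + (b t)\<^sup>2 - 6 * (P (?m t) * L) + (P (?m t))\<^sup>2" .
        show ?case
          unfolding h_def sum_eq using cuts not_nonneg_Reals_imp(4)[OF elim(2)]
          by (simp add: dilog_eq_slit P L_def)
      qed
    qed
  qed simp
  then show ?thesis
    unfolding h_def A_def B_def P_def Q_def X_def Y_def x_def y_def
    by (simp add: algebra_simps eq_neg_iff_add_eq_0)
qed

text \<open>Sum and product determine the pair up to order and the claim is symmetric, so the signs
  of \<open>root_disc\<close> and the principal roots need not be compared.\<close>

lemma three_term:
  assumes u: "u \<notin> \<real>\<^sub>\<ge>\<^sub>0" and sum: "x + y = 2 - u" and prod: "x * y = (1 - u)\<^sup>2"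
  shows "dilog_slit u - dilog_slit (1 / x) - dilog_slit (1 / y) =
    ((ln (1 - 1 / x))\<^sup>2 + (ln (1 - 1 / y))\<^sup>2 - 2 * ln (1 - u) * ln (- u)
       + (ln (1 - u))\<^sup>2 - (ln (- u))\<^sup>2 / 2) / 3 - (of_real pi)\<^sup>2 / 6"
proof -
  define x0 y0 where "x0 = (2 - root_disc u - u) / 2" and "y0 = (2 + root_disc u - u) / 2"
  have sum0: "x0 + y0 = 2 - u" and prod0: "x0 * y0 = (1 - u)\<^sup>2"
    unfolding x0_def y0_def using root_sum_prod[OF root_disc_sq[of u]] .
  have "(x - x0) * (x - y0) = x * x - x * (x0 + y0) + x0 * y0"
    by (simp add: algebra_simps)
  also have "\<dots> = x * x - x * (x + y) + x * y"
    unfolding sum0 prod0 sum prod ..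
  also have "\<dots> = 0" by (simp add: algebra_simps)
  finally have "x = x0 \<or> x = y0" by simp
  moreover have "y = x0 + y0 - x"
    using sum sum0 by (metis add_diff_cancel_left')
  ultimately consider "x = x0" "y = y0" | "x = y0" "y = x0" by fastforce
  then show ?thesis
  proof cases
    case 1
    then show ?thesis using three_term_root_disc[OF u, folded x0_def y0_def] by simp
  next
    case 2
    have "dilog_slit u - dilog_slit (1 / y0) - dilog_slit (1 / x0) =
        dilog_slit u - dilog_slit (1 / x0) - dilog_slit (1 / y0)" by simp
    with 2 show ?thesis
      using three_term_root_disc[OF u, folded x0_def y0_def] by (simp only: add.commute)
  qed
qed

lemma not_pos_reals_iff: "u \<notin> pos_reals \<and> u \<noteq> 0 \<longleftrightarrow> u \<notin> \<real>\<^sub>\<ge>\<^sub>0"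
  by (force simp: pos_reals_def complex_nonneg_Reals_iff complex_eq_iff image_iff)

text \<open>Inversion accounts for the terms with factor -1/2, even where x or y lies on the cut;
  the rest is \<open>three_term\<close>. The two inversions and \<open>three_term\<close> contribute
  -pi^2/6 each.\<close>

lemma L_dilog_eq_E_log:
  assumes u: "u \<notin> \<real>\<^sub>\<ge>\<^sub>0"
  shows "L_dilog u = E_log u"
proof -
  define s where "s = csqrt (4 - 3 * u) * csqrt u"
  define x y where "x = (2 - s - u) / 2" and "y = (2 + s - u) / 2"
  have sq: "s\<^sup>2 = u * (4 - 3 * u)" by (simp add: s_def power_mult_distrib mult.commute)
  then have sq': "(- s)\<^sup>2 = u * (4 - 3 * u)" by simp
  have x: "x \<notin> complex_of_real ` {0..1}" and y: "y \<notin> complex_of_real ` {0..1}"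
    using root_off_unit_interval[OF sq u] root_off_unit_interval[OF sq' u]
    by (simp_all add: x_def y_def)
  note x' = inverse_facts_off_unit_interval[OF x] and y' = inverse_facts_off_unit_interval[OF y]
  have ln_inv: "(ln (1 / (1 - 1 / w)))\<^sup>2 = (ln (1 - 1 / w))\<^sup>2" if "1 - 1 / w \<notin> \<real>\<^sub>\<le>\<^sub>0" for w :: complex
    using Ln_inverse[OF that] by (simp add: inverse_eq_divide)
  have s: "s = 2 * y - 2 + u" "s = 2 - 2 * x - u" by (simp_all add: x_def y_def field_simps)
  \<comment> \<open>The first two arguments are reciprocals of 1 - 1/y and 1 - 1/x, which does not
    affect squared logarithms.\<close>
  have args: "2 / (s - u) + 1 = 1 / (1 - 1 / y)" "1 - 2 / (u + s) = 1 / (1 - 1 / x)"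
    "2 / (- u + s + 2) = 1 / y" "2 / (u + s - 2) = - (1 / x)"
    using x' y' by (simp add: s(1) field_simps, simp add: s(2) field_simps, simp add: s(1), 
        simp add: s(2) field_simps)
  have E: "E_log u = 1/3 * (ln (1 - 1 / y))\<^sup>2 - 1/2 * (ln (- (1 / y)))\<^sup>2 - 1/2 * (ln (- (1 / x)))\<^sup>2
      + 1/3 * (ln (1 - 1 / x))\<^sup>2 - 2/3 * ln (1 - u) * ln (- u) + 1/3 * (ln (1 - u))\<^sup>2
      - 1/6 * (ln (- u))\<^sup>2 - (of_real pi)\<^sup>2 / 2"
    unfolding E_log_def s_def[symmetric] args ln_inv[OF x'(4)] ln_inv[OF y'(4)] ..
  have L: "L_dilog u = dilog x + dilog y + dilog u"
    by (simp add: L_dilog_def x_def y_def flip: s_def)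
  have "dilog u = dilog (1 / x) + dilog (1 / y) + ((ln (1 - 1 / x))\<^sup>2 + (ln (1 - 1 / y))\<^sup>2
      - 2 * ln (1 - u) * ln (- u) + (ln (1 - u))\<^sup>2 - (ln (- u))\<^sup>2 / 2) / 3 - (of_real pi)\<^sup>2 / 6"
    using three_term[OF u root_sum_prod[OF sq], folded x_def y_def] x'(3) y'(3)
      not_nonneg_Reals_imp(4)[OF u]
    by (simp add: dilog_eq_slit diff_eq_eq)
  note dilog_u = this
  show ?thesis
    unfolding L E dilog_inversion[OF x] dilog_inversion[OF y] dilog_u
    by (simp add: field_simps)
qed

section \<open>Positive arguments\<close>

text \<open>Separates the squares, whose real parts are continuous across the cut, from the product
  of two logarithms, whose limit is taken factor by factor.\<close>

lemma Re_E_log: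
  "Re (E_log u) =
     Re ((ln (2 / (csqrt (4 - 3 * u) * csqrt u - u) + 1))\<^sup>2) / 3
   - Re ((ln (- (2 / (- u + csqrt (4 - 3 * u) * csqrt u + 2))))\<^sup>2) / 2
   - Re ((ln (2 / (u + csqrt (4 - 3 * u) * csqrt u - 2)))\<^sup>2) / 2
   + Re ((ln (1 - 2 / (u + csqrt (4 - 3 * u) * csqrt u)))\<^sup>2) / 3
   - 2 / 3 * Re (ln (1 - u) * ln (- u)) + Re ((ln (1 - u))\<^sup>2) / 3 - Re ((ln (- u))\<^sup>2) / 6 - pi\<^sup>2 / 2"
proof -
  have "Re (1/3 * a - 1/2 * b - 1/2 * c + 1/3 * d - 2/3 * p * q + 1/3 * e - 1/6 * f - (of_real pi)\<^sup>2 / 2) =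
    Re a / 3 - Re b / 2 - Re c / 2 + Re d / 3 - 2 / 3 * Re (p * q) + Re e / 3 - Re f / 6 - pi\<^sup>2 / 2"
    for a b c d e f p q
    by (simp add: field_simps flip: of_real_power)
  then show ?thesis unfolding E_log_def .
qed

text \<open>Convergence of the root product is a hypothesis because \<open>csqrt (4 - 3 * u)\<close>
  jumps at real u > 4/3.\<close>

lemma tendsto_Re_L_dilog:
  assumes f: "(f \<longlongrightarrow> u) F"
    and s: "((\<lambda>t. csqrt (4 - 3 * f t) * csqrt (f t)) \<longlongrightarrow> csqrt (4 - 3 * u) * csqrt u) F"
  shows "((\<lambda>t. Re (L_dilog (f t))) \<longlongrightarrow> Re (L_dilog u)) F"
  unfolding L_dilog_def plus_complex.sel
  by (intro tendsto_intros isCont_tendsto_compose[OF isCont_Re_dilog] f s) auto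

text \<open>All denominators and arguments are nonzero by (2 - S - u)(2 + S - u) = 4 (1 - u)^2 and
  (S - u)(S + u) = 4 u (1 - u).\<close>

lemma tendsto_Re_E_log:
  assumes f: "(f \<longlongrightarrow> u) F" and u: "u \<noteq> 0" "u \<noteq> 1"
    and s: "((\<lambda>t. csqrt (4 - 3 * f t) * csqrt (f t)) \<longlongrightarrow> csqrt (4 - 3 * u) * csqrt u) F"
    and "((\<lambda>t. ln (1 - f t)) \<longlongrightarrow> ln (1 - u)) F" "((\<lambda>t. ln (- f t)) \<longlongrightarrow> ln (- u)) F"
  shows "((\<lambda>t. Re (E_log (f t))) \<longlongrightarrow> Re (E_log u)) F"
proof -
  define S where "S = csqrt (4 - 3 * u) * csqrt u"
  have sq: "S\<^sup>2 = u * (4 - 3 * u)" by (simp add: S_def power_mult_distrib mult.commute)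
  have "(2 - S - u) * (2 + S - u) = (2 - u)\<^sup>2 - S\<^sup>2"
    by (simp add: algebra_simps power2_eq_square)
  also have "\<dots> = 4 * (1 - u)\<^sup>2"
    unfolding sq by (simp add: algebra_simps power2_eq_square)
  finally have xy: "2 - S - u \<noteq> 0" "2 + S - u \<noteq> 0" using u by auto
  have "(S - u) * (S + u) = S\<^sup>2 - u * u"
    by (simp add: algebra_simps power2_eq_square)
  then have "(S - u) * (S + u) = 4 * u * (1 - u)"
    unfolding sq by (simp add: algebra_simps)
  then have xy1: "S - u \<noteq> 0" "u + S \<noteq> 0" using u by (auto simp: add.commute)
  have "2 / (S - u) + 1 = (2 + S - u) / (S - u)" "1 - 2 / (u + S) = - (2 - S - u) / (u + S)"
    using xy1 by (simp_all add: divide_simps)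
  then have "2 / (S - u) + 1 \<noteq> 0" "1 - 2 / (u + S) \<noteq> 0"
    using xy xy1 by (simp_all only: divide_eq_0_iff neg_equal_0_iff_equal not_False_eq_True simp_thms)
  moreover have "- u + S + 2 = 2 + S - u" "u + S - 2 = - (2 - S - u)" by simp_all
  then have "- u + S + 2 \<noteq> 0" "u + S - 2 \<noteq> 0"
    using xy by (simp_all only: neg_equal_0_iff_equal not_False_eq_True)
  ultimately have nz: "S - u \<noteq> 0" "u + S \<noteq> 0" "- u + S + 2 \<noteq> 0" "u + S - 2 \<noteq> 0" 
    "2 / (S - u) + 1 \<noteq> 0" "1 - 2 / (u + S) \<noteq> 0"
    using xy1 by - assumption+
  have Re_ln_sq: "((\<lambda>t. Re ((ln (g t))\<^sup>2)) \<longlongrightarrow> Re ((ln a)\<^sup>2)) F" if "(g \<longlongrightarrow> a) F" "a \<noteq> 0" for g a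
    using isCont_tendsto_compose[OF isCont_Re_ln_sq] that by blast
  define r where "r t = csqrt (4 - 3 * f t) * csqrt (f t)" for t
  have r: "(r \<longlongrightarrow> S) F" using s by (simp add: r_def[abs_def] S_def)
  have "((\<lambda>t. 2 / (r t - f t) + 1) \<longlongrightarrow> 2 / (S - u) + 1) F"
    by (intro tendsto_add tendsto_divide tendsto_diff tendsto_const r f nz)
  moreover have "((\<lambda>t. - (2 / (- f t + r t + 2))) \<longlongrightarrow> - (2 / (- u + S + 2))) F"
    by (intro tendsto_minus tendsto_divide tendsto_add tendsto_const r f nz)
  moreover have "((\<lambda>t. 2 / (f t + r t - 2)) \<longlongrightarrow> 2 / (u + S - 2)) F"
    by (intro tendsto_divide tendsto_diff tendsto_add tendsto_const r f nz)
  moreover have "((\<lambda>t. 1 - 2 / (f t + r t)) \<longlongrightarrow> 1 - 2 / (u + S)) F"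
    by (intro tendsto_divide tendsto_diff tendsto_add tendsto_const r f nz)
  moreover have "- (2 / (- u + S + 2)) \<noteq> 0" "2 / (u + S - 2) \<noteq> 0"
    using nz(3,4) by (simp_all only: divide_eq_0_iff neg_equal_0_iff_equal zero_neq_numeral[symmetric]
        not_False_eq_True simp_thms)
  ultimately have sq_lim: 
    "((\<lambda>t. Re ((ln (2 / (r t - f t) + 1))\<^sup>2)) \<longlongrightarrow> Re ((ln (2 / (S - u) + 1))\<^sup>2)) F"
    "((\<lambda>t. Re ((ln (- (2 / (- f t + r t + 2))))\<^sup>2)) \<longlongrightarrow> Re ((ln (- (2 / (- u + S + 2))))\<^sup>2)) F"
    "((\<lambda>t. Re ((ln (2 / (f t + r t - 2)))\<^sup>2)) \<longlongrightarrow> Re ((ln (2 / (u + S - 2)))\<^sup>2)) F"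
    "((\<lambda>t. Re ((ln (1 - 2 / (f t + r t)))\<^sup>2)) \<longlongrightarrow> Re ((ln (1 - 2 / (u + S)))\<^sup>2)) F"
    using nz(5,6) by - (rule Re_ln_sq; assumption)+
  have "3 \<noteq> (0::real)" "2 \<noteq> (0::real)" "6 \<noteq> (0::real)" by simp_all
  then show ?thesis
    unfolding Re_E_log r_def[symmetric] S_def[symmetric]
    by - (intro tendsto_add[of _ _ F] tendsto_diff tendsto_divide sq_lim tendsto_mult[OF tendsto_const]
        tendsto_Re[OF tendsto_mult] tendsto_Re[OF tendsto_power] tendsto_const assms(5,6); assumption)
qed

text \<open>The point is approached from below: then 4 - 3 f, 1 - f and -f lie in the upper
  half-plane, from where roots and logarithms tend to their principal values.\<close>

lemma Re_L_dilog_eq_E_log: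
  fixes u :: real
  assumes u: "u > 0" "u \<noteq> 1"
  shows "Re (L_dilog (of_real u)) = Re (E_log (of_real u))"
proof -
  let ?f = "\<lambda>t. of_real u - of_real t * \<i>"
  have pos: "\<forall>\<^sub>F t in at_right (0::real). t > 0"
    by (rule eventually_at_rightI[of 0 1]) auto
  have f: "(?f \<longlongrightarrow> of_real u) (at_right 0)"
    by (auto intro!: tendsto_eq_intros)
  have s: "((\<lambda>t. csqrt (4 - 3 * ?f t) * csqrt (?f t)) \<longlongrightarrow>
      csqrt (4 - 3 * of_real u) * csqrt (of_real u)) (at_right 0)"
  proof (intro tendsto_mult)
    show "((\<lambda>t. csqrt (4 - 3 * ?f t)) \<longlongrightarrow> csqrt (4 - 3 * of_real u)) (at_right 0)"
      by (intro tendsto_csqrt_upper tendsto_intros f) (use pos in \<open>auto elim: eventually_mono\<close>)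
    show "((\<lambda>t. csqrt (?f t)) \<longlongrightarrow> csqrt (of_real u)) (at_right 0)"
      by (rule isCont_tendsto_compose[OF continuous_at_csqrt f]) (use u in auto)
  qed
  have "((\<lambda>t. ln (1 - ?f t)) \<longlongrightarrow> ln (1 - of_real u)) (at_right 0)"
    by (intro tendsto_ln_upper tendsto_intros f) 
       (use u pos in \<open>auto elim: eventually_mono simp: complex_eq_iff\<close>)
  moreover have "((\<lambda>t. ln (- ?f t)) \<longlongrightarrow> ln (- of_real u)) (at_right 0)"
    by (intro tendsto_ln_upper tendsto_intros f) (use u pos in \<open>auto elim: eventually_mono\<close>)
  ultimately have E: "((\<lambda>t. Re (E_log (?f t))) \<longlongrightarrow> Re (E_log (of_real u))) (at_right 0)"
    using u by (intro tendsto_Re_E_log f s) auto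
  have "((\<lambda>t. Re (E_log (?f t))) \<longlongrightarrow> Re (L_dilog (of_real u))) (at_right 0)"
    using tendsto_Re_L_dilog[OF f s]
  proof (rule Lim_transform_eventually)
    show "\<forall>\<^sub>F t in at_right 0. Re (L_dilog (?f t)) = Re (E_log (?f t))"
      using pos by eventually_elim (subst L_dilog_eq_E_log, auto simp: complex_nonneg_Reals_iff)
  qed
  with E show ?thesis by (intro tendsto_unique) simp_all
qed

section \<open>One-sided limits of the imaginary parts\<close>

text \<open>The imaginary part of the quadratic gives x = 2 (1 - Re u); the real part then puts u on
  a hyperbola, which a vertical line meets in at most two points.\<close>

lemma real_root_relation:
  assumes sum: "x + y = 2 - u" and prod: "x * y = (1 - u)\<^sup>2" and Im: "Im u \<noteq> 0" "Im x = 0"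
  shows "(Im u)\<^sup>2 = (1 - Re u) * (1 - 3 * Re u)"
proof -
  define p q t where "p = Re u" and "q = Im u" and "t = Re x"
  have u_eq: "u = Complex p q" and x_eq: "x = of_real t"
    using Im by (simp_all add: p_def q_def t_def complex_eq_iff)
  have "y = 2 - u - x" using sum by (simp add: algebra_simps)
  then have "x * (2 - u - x) = (1 - u)\<^sup>2" using prod by simp
  then have *: "t * (2 - p - t) = (1 - p)\<^sup>2 - q\<^sup>2" "t * q = 2 * (1 - p) * q"
    by (simp_all add: complex_eq_iff x_eq u_eq power2_eq_square algebra_simps)
  have "t = 2 * (1 - p)" using *(2) Im(1) by (metis mult_right_cancel q_def)
  with *(1) show ?thesis
    by (simp add: power2_eq_square algebra_simps flip: p_def q_def)
qed

text \<open>A short vertical segment starting at u misses the hyperbola, so both roots stay non-real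
  along it; \<open>\<sigma>\<close> selects the side.\<close>

lemma L_dilog_one_sided_limit:
  fixes u \<sigma> :: real
  assumes u: "u > 0" and \<sigma>: "\<sigma> = 1 \<or> \<sigma> = - 1"
  shows "\<exists>l. ((\<lambda>b. L_dilog (of_real u + of_real (\<sigma> * b) * \<i>)) \<longlongrightarrow> l) (at_right 0)"
proof -
  define g where "g b = of_real u + of_real (\<sigma> * b) * \<i>" for b
  define s where "s b = csqrt (4 - 3 * g b) * csqrt (g b)" for b
  \<comment> \<open>\<open>c\<close> is the value of b^2 on the hyperbola above u; \<open>e\<close>
    stops there, and is arbitrary if no b > 0 is hit.\<close>
  define c e where "c = (1 - u) * (1 - 3 * u)" and "e = (if c > 0 then sqrt c else 1)"
  have pos: "\<forall>\<^sub>F b in at_right (0::real). b > 0"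
    by (rule eventually_at_rightI[of 0 1]) auto
  have g: "(g \<longlongrightarrow> of_real u) (at_right 0)"
    unfolding g_def by (auto intro!: tendsto_eq_intros)
  have g': "((\<lambda>b. 4 - 3 * g b) \<longlongrightarrow> 4 - 3 * of_real u) (at_right 0)"
    by (intro tendsto_intros g)
  have "\<exists>l. ((\<lambda>b. csqrt (4 - 3 * g b)) \<longlongrightarrow> l) (at_right 0)"
    using \<sigma>
  proof
    assume "\<sigma> = 1"
    then have "\<forall>\<^sub>F b in at_right 0. Im (4 - 3 * g b) < 0"
      using pos by (auto simp: g_def elim: eventually_mono)
    then show ?thesis using tendsto_csqrt_lower[OF g'] by blast
  next
    assume "\<sigma> = - 1"
    then have "\<forall>\<^sub>F b in at_right 0. Im (4 - 3 * g b) \<ge> 0"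
      using pos by (auto simp: g_def elim: eventually_mono)
    then show ?thesis using tendsto_csqrt_upper[OF g'] by blast
  qed
  then obtain l where "((\<lambda>b. csqrt (4 - 3 * g b)) \<longlongrightarrow> l) (at_right 0)" ..
  moreover have "((\<lambda>b. csqrt (g b)) \<longlongrightarrow> csqrt (of_real u)) (at_right 0)"
    by (rule isCont_tendsto_compose[OF continuous_at_csqrt g]) (use u in auto)
  ultimately have s: "(s \<longlongrightarrow> l * csqrt (of_real u)) (at_right 0)"
    unfolding s_def by (rule tendsto_mult)
  have e: "e > 0" by (simp add: e_def)
  have Im_g: "Im (g b) \<noteq> 0" if "b \<in> {0<..<e}" for b
    using that \<sigma> by (auto simp: g_def)
  have cont_g: "continuous_on {0<..<e} g"
    unfolding g_def by (intro continuous_intros)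
  have cont_s: "continuous_on {0<..<e} s"
  proof -
    have csqrt: "continuous_on {0<..<e} (\<lambda>b. csqrt (h b))"
      if "continuous_on {0<..<e} h" "\<And>b. b \<in> {0<..<e} \<Longrightarrow> Im (h b) \<noteq> 0" for h
      by (rule continuous_on_compose2[of "- \<real>\<^sub>\<le>\<^sub>0" csqrt])
         (use that in \<open>auto intro!: continuous_on_csqrt simp: complex_nonpos_Reals_iff\<close>)
    show ?thesis
      unfolding s_def using Im_g by (intro continuous_on_mult csqrt continuous_intros cont_g) auto
  qed
  have sq: "(s b)\<^sup>2 = g b * (4 - 3 * g b)" for b
    by (simp add: s_def power_mult_distrib mult.commute)
  have "(Im (g b))\<^sup>2 \<noteq> (1 - Re (g b)) * (1 - 3 * Re (g b))" if b: "b \<in> {0<..<e}" for b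
  proof -
    have "b\<^sup>2 \<noteq> c"
    proof
      assume "b\<^sup>2 = c"
      moreover from this b have "c > 0" by auto
      ultimately have "b = e" using b by (auto simp: e_def real_sqrt_unique)
      with b show False by simp
    qed
    moreover have "(Im (g b))\<^sup>2 = b\<^sup>2" using \<sigma> by (auto simp: g_def)
    ultimately show ?thesis by (simp add: g_def c_def)
  qed
  then have Im_root: "Im x \<noteq> 0" if "b \<in> {0<..<e}" "x + y = 2 - g b" "x * y = (1 - g b)\<^sup>2" for b x y
    using real_root_relation[OF that(2,3) Im_g[OF that(1)]] that(1) by blast
  have Im_x: "Im ((2 - s b - g b) / 2) \<noteq> 0" if "b \<in> {0<..<e}" for b
    by (rule Im_root[OF that root_sum_prod[OF sq]])
  have Im_y: "Im ((2 + s b - g b) / 2) \<noteq> 0" if "b \<in> {0<..<e}" for b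
    by (rule Im_root[OF that]) (subst add.commute mult.commute, rule root_sum_prod[OF sq])+
  have "\<exists>l. ((\<lambda>b. dilog ((2 - s b - g b) / 2)) \<longlongrightarrow> l) (at_right 0)"
  proof (rule dilog_one_sided_limit[OF e])
    show "continuous_on {0<..<e} (\<lambda>b. (2 - s b - g b) / 2)"
      by (intro continuous_intros cont_s cont_g) simp
    show "((\<lambda>b. (2 - s b - g b) / 2) \<longlongrightarrow> (2 - l * csqrt (of_real u) - of_real u) / 2) (at_right 0)"
      by (intro tendsto_intros s g) simp
  qed (rule Im_x)
  then obtain l1 where l1: "((\<lambda>b. dilog ((2 - s b - g b) / 2)) \<longlongrightarrow> l1) (at_right 0)" ..
  have "\<exists>l. ((\<lambda>b. dilog ((2 + s b - g b) / 2)) \<longlongrightarrow> l) (at_right 0)"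
  proof (rule dilog_one_sided_limit[OF e])
    show "continuous_on {0<..<e} (\<lambda>b. (2 + s b - g b) / 2)"
      by (intro continuous_intros cont_s cont_g) simp
    show "((\<lambda>b. (2 + s b - g b) / 2) \<longlongrightarrow> (2 + l * csqrt (of_real u) - of_real u) / 2) (at_right 0)"
      by (intro tendsto_intros s g) simp
  qed (rule Im_y)
  then obtain l2 where l2: "((\<lambda>b. dilog ((2 + s b - g b) / 2)) \<longlongrightarrow> l2) (at_right 0)" ..
  obtain l3 where l3: "((\<lambda>b. dilog (g b)) \<longlongrightarrow> l3) (at_right 0)"
    using dilog_one_sided_limit[OF e cont_g Im_g g] by auto
  from tendsto_add[OF tendsto_add[OF l1 l2] l3] show ?thesis
    unfolding L_dilog_def by (auto simp: s_def g_def)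
qed

text \<open>Both functions agree for b > 0, so the limit of \<open>L_dilog\<close> carries over to
  \<open>E_log\<close>.\<close>

lemma Im_one_sided_limits:
  fixes u \<sigma> :: real
  assumes u: "u > 0" and \<sigma>: "\<sigma> = 1 \<or> \<sigma> = - 1"
  shows "\<exists>l. ((\<lambda>b. Im (L_dilog (of_real u + of_real (\<sigma> * b) * \<i>))) \<longlongrightarrow> l) (at_right 0)
    \<and> ((\<lambda>b. Im (E_log (of_real u + of_real (\<sigma> * b) * \<i>))) \<longlongrightarrow> l) (at_right 0)"
proof -
  let ?g = "\<lambda>b. of_real u + of_real (\<sigma> * b) * \<i>"
  obtain l where "((\<lambda>b. L_dilog (?g b)) \<longlongrightarrow> l) (at_right 0)"
    using L_dilog_one_sided_limit[OF u \<sigma>] ..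
  then have L: "((\<lambda>b. Im (L_dilog (?g b))) \<longlongrightarrow> Im l) (at_right 0)"
    by (rule tendsto_Im)
  have "\<forall>\<^sub>F b in at_right 0. b > (0::real)"
    by (rule eventually_at_rightI[of 0 1]) auto
  then have "\<forall>\<^sub>F b in at_right 0. Im (L_dilog (?g b)) = Im (E_log (?g b))"
    by eventually_elim (subst L_dilog_eq_E_log, use \<sigma> in \<open>auto simp: complex_nonneg_Reals_iff\<close>)
  with L have "((\<lambda>b. Im (E_log (?g b))) \<longlongrightarrow> Im l) (at_right 0)"
    by (rule Lim_transform_eventually)
  with L show ?thesis by blast
qed

section \<open>The removable singularities\<close>

text \<open>The arguments of the dilogarithms tend to 1, 1 and 0, where \<open>dilog\<close> is
  continuous, since \<open>csqrt\<close> is continuous at 0.\<close>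

lemma tendsto_E_log_0: "(E_log \<longlongrightarrow> L_dilog 0) (at 0 within - pos_reals)"
proof (rule Lim_transform_eventually)
  define s where "s u = csqrt (4 - 3 * u) * csqrt u" for u
  have s: "(s \<longlongrightarrow> s 0) (at 0 within - pos_reals)"
    unfolding s_def
    by (intro tendsto_mult isCont_tendsto_compose[OF isCont_csqrt_0] 
          isCont_tendsto_compose[OF continuous_at_csqrt] tendsto_intros) auto
  show "(L_dilog \<longlongrightarrow> L_dilog 0) (at 0 within - pos_reals)"
    unfolding L_dilog_def s_def[symmetric]
    by (intro tendsto_intros isCont_tendsto_compose[OF isCont_dilog] s)
       (auto simp: in_dilog_cut_iff s_def)
  show "\<forall>\<^sub>F u in at 0 within - pos_reals. L_dilog u = E_log u"
    unfolding eventually_at_filter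
    by (intro always_eventually allI impI L_dilog_eq_E_log) (auto simp flip: not_pos_reals_iff)
qed

text \<open>Near 1 both square roots are away from their cut, so the real part of
  \<open>L_dilog\<close> is continuous there and its limit passes to \<open>E_log\<close>.\<close>

lemma tendsto_Re_E_log_1:
  "((\<lambda>u::real. Re (E_log (of_real u))) \<longlongrightarrow> Re (L_dilog 1)) (at 1)"
proof (rule Lim_transform_eventually)
  have f: "(complex_of_real \<longlongrightarrow> 1) (at 1)"
    by (auto intro!: tendsto_eq_intros)
  show "((\<lambda>u::real. Re (L_dilog (of_real u))) \<longlongrightarrow> Re (L_dilog 1)) (at 1)"
    by (intro tendsto_Re_L_dilog f tendsto_mult 
          isCont_tendsto_compose[OF continuous_at_csqrt] tendsto_intros) auto
  have "\<forall>\<^sub>F u in at (1::real). u \<in> {0<..} - {1}"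
    by (intro eventually_at_in_open) auto
  then show "\<forall>\<^sub>F u::real in at 1. Re (L_dilog (of_real u)) = Re (E_log (of_real u))"
    by eventually_elim (auto intro: Re_L_dilog_eq_E_log)
qed

(* E_log has removable singularities at 0 and 1, where the identity is read as a limit.  The
   imaginary parts have a limit as b tends to 0 from either side, but in general the two one-sided
   limits differ in sign. *)
theorem theorem3:
  shows "(\<forall>u. u \<notin> pos_reals \<and> u \<noteq> 0 \<longrightarrow> L_dilog u = E_log u)
    \<and> (E_log \<longlongrightarrow> L_dilog 0) (at 0 within - pos_reals)
    \<and> (\<forall>u::real. u > 0 \<and> u \<noteq> 1 \<longrightarrow>
          Re (L_dilog (of_real u)) = Re (E_log (of_real u)))
    \<and> ((\<lambda>u::real. Re (E_log (of_real u))) \<longlongrightarrow> Re (L_dilog 1)) (at 1)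
    \<and> (\<forall>u::real. u > 0 \<longrightarrow>
          (\<exists>l. ((\<lambda>b::real. Im (L_dilog (of_real u + of_real b * \<i>))) \<longlongrightarrow> l) (at_right 0)
             \<and> ((\<lambda>b::real. Im (E_log (of_real u + of_real b * \<i>))) \<longlongrightarrow> l) (at_right 0))
        \<and> (\<exists>l. ((\<lambda>b::real. Im (L_dilog (of_real u + of_real b * \<i>))) \<longlongrightarrow> l) (at_left 0)
             \<and> ((\<lambda>b::real. Im (E_log (of_real u + of_real b * \<i>))) \<longlongrightarrow> l) (at_left 0)))"
proof (intro conjI allI impI)
  show "L_dilog u = E_log u" if "u \<notin> pos_reals \<and> u \<noteq> 0" for u
    using that L_dilog_eq_E_log not_pos_reals_iff by blast
next
  fix u :: real assume u: "u > 0"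
  show "\<exists>l. ((\<lambda>b::real. Im (L_dilog (of_real u + of_real b * \<i>))) \<longlongrightarrow> l) (at_right 0)
     \<and> ((\<lambda>b::real. Im (E_log (of_real u + of_real b * \<i>))) \<longlongrightarrow> l) (at_right 0)"
    using Im_one_sided_limits[OF u, of 1] by simp
  show "\<exists>l. ((\<lambda>b::real. Im (L_dilog (of_real u + of_real b * \<i>))) \<longlongrightarrow> l) (at_left 0)
     \<and> ((\<lambda>b::real. Im (E_log (of_real u + of_real b * \<i>))) \<longlongrightarrow> l) (at_left 0)"
    \<comment> \<open>The reflection of b turns the limit from the left into one from the
      right.\<close>
    using Im_one_sided_limits[OF u, of "- 1"] by (simp add: filterlim_at_left_to_right)
qed (use tendsto_E_log_0 tendsto_Re_E_log_1 Re_L_dilog_eq_E_log in auto)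

end
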